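(* Let us assume that there exists a linear spectral problem (LSP) of the form $$D_j\Psi(\lambda,[u])-U_j(\lambda,[u])\Psi(\lambda,[u])=0,\qquad j=1,2,$$ associated with a SUSY integrable system of PDEs $\Delta[u]=0$, where $\Psi(\lambda,[u])\in GL(p\vert q,\mathbb{G})$, the $U_j(\lambda,[u])$ are fermionic supermatrices in $\mathfrak{gl}(p\vert q,\mathbb{G})$ and $\lambda$ is a spectral parameter, such that the zero-curvature condition (ZCC) $$D_1U_2+D_2U_1-\{EU_1,EU_2\}=0$$ is, for any value of $\lambda$, equivalent to $\Delta[u]=0$. Consider the fermionic parameter deformations $$\tilde U_1=U_1+\epsilon EA_1,\qquad \tilde U_2=U_2+\epsilon EA_2,\qquad \tilde\Psi=\Psi(I+\epsilon EF),$$ where $\epsilon$ is a fermionic parameter and $A_1(\lambda,[u]),A_2(\lambda,[u])$ are bosonic supermatrices in $\mathfrak{gl}(p\vert q,\mathbb{G})$, and suppose that these deformations preserve both the LSP and the ZCC, i.e. $A_1,A_2$ and $F$ must satisfy the deformed LSP $$D_j\tilde\Psi=\tilde U_j\tilde\Psi,\qquad j=1,2,$$ the tangent vector equations $$ED_j(F)=-\Psi^{-1}EA_j\Psi,\qquad j=1,2$$ (these follow from the deformed LSP up to the addition of a bosonic supermatrix $R$ such that $\epsilon R=0$), and the deformed ZCC $$D_1A_2+D_2A_1+[EA_1,EU_2]+[EA_2,EU_1]=0.$$ Then there exists an immersion fermionic supermatrix $F(\lambda,[u])$ in $\mathfrak{gl}(p\vert q,\mathbb{G})$ which defines a 2D surface,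 provided that its tangent vectors $ED_j(F)=-\Psi^{-1}EA_j\Psi$, $j=1,2$, are linearly independent.
   Context: $\mathbb{G}$ is a complex Grassmann algebra generated by the unit and (sufficiently many) anticommuting odd generators, graded by parity; "even/odd" is synonymous with "bosonic/fermionic". A square $(p+q)\times(p+q)$ supermatrix $M=\begin{pmatrix}A&B\\C&D\end{pmatrix}$ ($A$ of size $p\times p$, $D$ of size $q\times q$) is even (bosonic) if the entries of $A,D$ are even and those of $B,C$ are odd, and odd (fermionic) if the entries of $A,D$ are odd and those of $B,C$ are even. $\mathfrak{gl}(p\vert q,\mathbb{G})$ is the Lie superalgebra of such supermatrices and $GL(p\vert q,\mathbb{G})$ is the Lie supergroup of invertible even ones. $I$ is the identity matrix, $E=\begin{pmatrix}I_p&0\\0&-I_q\end{pmatrix}$, $\{M,N\}=MN+NM$ and $[M,N]=MN-NM$. The system $\Delta[u]=0$ is in terms of the bosonic independent variables $x_1,x_2$, the fermionic independent variables $\theta^1,\theta^2$, and the SUSY dependent variables $u^k$ and their derivatives; $[u]$ denotes the collection of independent variables, dependent variables and derivatives of the latter. The covariant derivatives are $D_j=\partial_{\theta^j}-i\theta^j\partial_{x_j}$, $j=1,2$; they satisfy $\{D_1,D_2\}=0$ and $D_j^2=-i\partial_{x_j}$. Odd derivatives satisfy $\partial_{\theta^j}(hg)=(\partial_{\theta^j}h)g+(-1)^{\deg h}h\,\partial_{\theta^j}g$. Odd derivatives and odd scalars act on supermatrices entrywise, with no implicit sign inserted in the lower blocks (signs are put in explicitly through $E$). The supermatrix $F$ is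 called the deformed surface and $ED_1(F),ED_2(F)$ are its tangent vectors. *)

theory Defs
  imports "HOL-Analysis.Analysis"
begin

section \<open>Finitely generated complex Grassmann algebras\<close>

text \<open>
  An element of the Grassmann algebra with odd generators \<open>'g\<close> is given by its coefficients
  with respect to the ordered monomials indexed by the sets of generators.
\<close>

typedef 'g grassmann = "UNIV :: ('g set \<Rightarrow> complex) set"
  morphisms coeff Grassmann ..

setup_lifting type_definition_grassmann

lemma coeff_Grassmann [simp]: "coeff (Grassmann f) = f"
  by (simp add: Grassmann_inverse)

lemma grassmann_eq_iff: "a = b \<longleftrightarrow> (\<forall>S. coeff a S = coeff b S)"
  by (metis coeff_inject ext)

definition inversions :: "'g::linorder set \<Rightarrow> 'g set \<Rightarrow> nat" where
  "inversions S T = card {(s, t). s \<in> S \<and> t \<in> T \<and> t < s}"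

text \<open>
  For disjoint \<open>S\<close> and \<open>T\<close>, sorting the product of the monomials of \<open>S\<close> and \<open>T\<close>
  produces the sign \<open>koszul S T\<close>.
\<close>

definition koszul :: "'g::linorder set \<Rightarrow> 'g set \<Rightarrow> complex" where
  "koszul S T = (- 1) ^ inversions S T"

lemma koszul_empty [simp]: "koszul {} S = 1" "koszul S {} = 1"
  by (simp_all add: koszul_def inversions_def)

lemma finite_inversions:
  fixes S T :: "'g::{finite,linorder} set"
  shows "finite {(s, t). s \<in> S \<and> t \<in> T \<and> t < s}"
  by (rule finite_subset[of _ "S \<times> T"]) auto

lemma koszul_Un_left:
  fixes S T W :: "'g::{finite,linorder} set"
  assumes "S \<inter> T = {}"
  shows "koszul (S \<union> T) W = koszul S W * koszul T W"
proof -
  have "{(s, t). s \<in> S \<union> T \<and> t \<in> W \<and> t < s} =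
      {(s, t). s \<in> S \<and> t \<in> W \<and> t < s} \<union> {(s, t). s \<in> T \<and> t \<in> W \<and> t < s}"
    by auto
  then have "inversions (S \<union> T) W = inversions S W + inversions T W"
    unfolding inversions_def
    using card_Un_disjoint[OF finite_inversions[of S W] finite_inversions[of T W]] assms
    by auto
  then show ?thesis
    by (simp add: koszul_def power_add)
qed

lemma koszul_Un_right:
  fixes S T W :: "'g::{finite,linorder} set"
  assumes "T \<inter> W = {}"
  shows "koszul S (T \<union> W) = koszul S T * koszul S W"
proof -
  have "{(s, t). s \<in> S \<and> t \<in> T \<union> W \<and> t < s} =
      {(s, t). s \<in> S \<and> t \<in> T \<and> t < s} \<union> {(s, t). s \<in> S \<and> t \<in> W \<and> t < s}"
    by auto
  then have "inversions S (T \<union> W) = inversions S T + inversions S W"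
    unfolding inversions_def
    using card_Un_disjoint[OF finite_inversions[of S T] finite_inversions[of S W]] assms
    by auto
  then show ?thesis
    by (simp add: koszul_def power_add)
qed

instantiation grassmann :: (type) ab_group_add
begin

lift_definition zero_grassmann :: "'a grassmann" is "\<lambda>S. 0" .
lift_definition plus_grassmann :: "'a grassmann \<Rightarrow> 'a grassmann \<Rightarrow> 'a grassmann"
  is "\<lambda>a b S. a S + b S" .
lift_definition minus_grassmann :: "'a grassmann \<Rightarrow> 'a grassmann \<Rightarrow> 'a grassmann"
  is "\<lambda>a b S. a S - b S" .
lift_definition uminus_grassmann :: "'a grassmann \<Rightarrow> 'a grassmann"
  is "\<lambda>a S. - a S" .

instance
  by standard (transfer; auto simp: fun_eq_iff)+

end

lemmas coeff_simps [simp] =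
  zero_grassmann.rep_eq plus_grassmann.rep_eq minus_grassmann.rep_eq uminus_grassmann.rep_eq

instantiation grassmann :: ("{finite,linorder}") ring_1
begin

lift_definition one_grassmann :: "'a grassmann" is "\<lambda>S. if S = {} then 1 else 0" .

lift_definition times_grassmann :: "'a grassmann \<Rightarrow> 'a grassmann \<Rightarrow> 'a grassmann"
  is "\<lambda>a b S. \<Sum>T\<in>Pow S. koszul T (S - T) * a T * b (S - T)" .

instance
proof
  fix a b c :: "'a grassmann"
  show "a * b * c = a * (b * c)"
  proof (transfer, rule ext)
    fix a b c :: "'a set \<Rightarrow> complex" and S :: "'a set"
    have "(\<Sum>X\<in>Pow S. koszul X (S - X) * (\<Sum>T\<in>Pow X. koszul T (X - T) * a T * b (X - T)) * c (S - X))
      = (\<Sum>(X, T)\<in>Sigma (Pow S) Pow.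
          koszul X (S - X) * koszul T (X - T) * a T * b (X - T) * c (S - X))"
      by (simp add: sum_distrib_left sum_distrib_right sum.Sigma[symmetric] mult_ac)
    also have "\<dots> = (\<Sum>(T, Y)\<in>Sigma (Pow S) (\<lambda>T. Pow (S - T)).
          koszul T (S - T) * koszul Y (S - T - Y) * a T * b Y * c (S - T - Y))"
    proof (rule sum.reindex_bij_witness[where i = "\<lambda>(T, Y). (T \<union> Y, T)" and j = "\<lambda>(X, T). (T, X - T)"])
      fix p assume p: "p \<in> Sigma (Pow S) Pow"
      obtain X T where XT: "p = (X, T)" by (cases p)
      then have "X \<subseteq> S" "T \<subseteq> X" using p by auto
      then have *: "T \<union> (X - T) = X" "(X - T) \<union> (S - X) = S - T" "S - T - (X - T) = S - X"
        "T \<inter> (X - T) = {}" "(X - T) \<inter> (S - X) = {}"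
        by auto
      have k1: "koszul X (S - X) = koszul T (S - X) * koszul (X - T) (S - X)"
        using koszul_Un_left[OF *(4), of "S - X"] unfolding *(1) .
      have k2: "koszul T (S - T) = koszul T (X - T) * koszul T (S - X)"
        using koszul_Un_right[OF *(5), of T] unfolding *(2) .
      show "(case (case p of (X, T) \<Rightarrow> (T, X - T)) of (T, Y) \<Rightarrow>
          koszul T (S - T) * koszul Y (S - T - Y) * a T * b Y * c (S - T - Y)) =
        (case p of (X, T) \<Rightarrow> koszul X (S - X) * koszul T (X - T) * a T * b (X - T) * c (S - X))"
        unfolding XT prod.case *(3) k1 k2 by (simp only: mult_ac)
    qed auto
    also have "\<dots> = (\<Sum>T\<in>Pow S. koszul T (S - T) * a T *
        (\<Sum>Y\<in>Pow (S - T). koszul Y (S - T - Y) * b Y * c (S - T - Y)))"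
      by (simp add: sum_distrib_left sum_distrib_right sum.Sigma[symmetric] mult_ac)
    finally show "(\<Sum>X\<in>Pow S. koszul X (S - X) *
        (\<Sum>T\<in>Pow X. koszul T (X - T) * a T * b (X - T)) * c (S - X)) = \<dots>" .
  qed
next
  fix a :: "'a grassmann"
  show "1 * a = a"
  proof (transfer, rule ext)
    fix a :: "'a set \<Rightarrow> complex" and S
    have "(\<Sum>T\<in>Pow S. koszul T (S - T) * (if T = {} then 1 else 0) * a (S - T)) =
        (\<Sum>T\<in>Pow S. if T = {} then a S else 0)"
      by (rule sum.cong) auto
    then show "(\<Sum>T\<in>Pow S. koszul T (S - T) * (if T = {} then 1 else 0) * a (S - T)) = a S"
      by simp
  qed
  show "a * 1 = a"
  proof (transfer, rule ext)
    fix a :: "'a set \<Rightarrow> complex" and S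
    have "(\<Sum>T\<in>Pow S. koszul T (S - T) * a T * (if S - T = {} then 1 else 0)) =
        (\<Sum>T\<in>Pow S. if T = S then a S else 0)"
      by (rule sum.cong) auto
    then show "(\<Sum>T\<in>Pow S. koszul T (S - T) * a T * (if S - T = {} then 1 else 0)) = a S"
      by simp
  qed
next
  fix a b c :: "'a grassmann"
  show "(a + b) * c = a * c + b * c"
    by transfer (auto simp: fun_eq_iff sum.distrib ring_distribs)
  show "a * (b + c) = a * b + a * c"
    by transfer (auto simp: fun_eq_iff sum.distrib ring_distribs)
next
  show "0 \<noteq> (1 :: 'a grassmann)"
    by transfer (auto simp: fun_eq_iff intro!: exI[of _ "{}"])
qed

end

definition of_complex :: "complex \<Rightarrow> 'g grassmann" where
  "of_complex c = Grassmann (\<lambda>S. if S = {} then c else 0)"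

definition gen :: "'g \<Rightarrow> 'g grassmann" where
  "gen g = Grassmann (\<lambda>S. if S = {g} then 1 else 0)"

definition bosonic :: "'g grassmann \<Rightarrow> bool" where
  "bosonic a \<longleftrightarrow> (\<forall>S. odd (card S) \<longrightarrow> coeff a S = 0)"

definition fermionic :: "'g grassmann \<Rightarrow> bool" where
  "fermionic a \<longleftrightarrow> (\<forall>S. even (card S) \<longrightarrow> coeff a S = 0)"

text \<open>The left derivative: move \<open>g\<close> to the front of each monomial containing it, then drop it.\<close>

definition dgen :: "'g::linorder \<Rightarrow> 'g grassmann \<Rightarrow> 'g grassmann" where
  "dgen g a = Grassmann (\<lambda>S. if g \<in> S then 0 else koszul {g} S * coeff a (insert g S))"

lemma coeff_times:
  "coeff (a * b) S = (\<Sum>T\<in>Pow S. koszul T (S - T) * coeff a T * coeff b (S - T))"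
  for a b :: "'g::{finite,linorder} grassmann"
  by transfer simp

lemma coeff_gen_times:
  fixes a :: "'g::{finite,linorder} grassmann"
  shows "coeff (gen g * a) S = (if g \<in> S then koszul {g} (S - {g}) * coeff a (S - {g}) else 0)"
proof -
  have "coeff (gen g * a) S =
      (\<Sum>T\<in>Pow S. if T = {g} then koszul {g} (S - {g}) * coeff a (S - {g}) else 0)"
    unfolding coeff_times gen_def by (rule sum.cong) auto
  then show ?thesis by simp
qed

lemma gen_anticommute: "gen g * gen h = - (gen h * gen g)"
  for g h :: "'g::{finite,linorder}"
proof -
  have *: "koszul {g} {h} = - koszul {h} {g}" if "g \<noteq> h"
  proof -
    have i: "inversions {a} {b} = (if b < a then 1 else 0)" for a b :: 'g
    proof (cases "b < a")
      case True
      then have "{(s, t). s \<in> {a} \<and> t \<in> {b} \<and> t < s} = {(a, b)}" by auto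
      then show ?thesis using True by (simp add: inversions_def)
    next
      case False
      then have "{(s, t). s \<in> {a} \<and> t \<in> {b} \<and> t < s} = {}" by auto
      then show ?thesis using False by (simp only: inversions_def) simp
    qed
    show ?thesis
      using that by (cases g h rule: linorder_cases) (simp_all add: koszul_def i)
  qed
  have c: "coeff (gen a * gen b) S = (if a \<noteq> b \<and> S = {a, b} then koszul {a} {b} else 0)"
    for a b :: 'g and S
  proof -
    have "a \<in> S \<and> S - {a} = {b} \<longleftrightarrow> a \<noteq> b \<and> S = {a, b}"
    proof
      assume *: "a \<in> S \<and> S - {a} = {b}"
      then have "b \<in> S - {a}" by simp
      then show "a \<noteq> b \<and> S = {a, b}" using * by (metis Diff_iff insert_Diff singletonI)
    next
      assume "a \<noteq> b \<and> S = {a, b}"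
      then show "a \<in> S \<and> S - {a} = {b}" by simp
    qed
    moreover have "coeff (gen a * gen b) S =
        (if a \<in> S \<and> S - {a} = {b} then koszul {a} (S - {a}) else 0)"
      by (simp add: coeff_gen_times) (simp add: gen_def)
    ultimately show ?thesis
      by auto
  qed
  show ?thesis
    unfolding grassmann_eq_iff
  proof
    fix S
    show "coeff (gen g * gen h) S = coeff (- (gen h * gen g)) S"
    proof (cases "g \<noteq> h \<and> S = {g, h}")
      case True
      then show ?thesis using * by (auto simp: c insert_commute)
    next
      case False
      then have "\<not> (h \<noteq> g \<and> S = {h, g})" by (auto simp: insert_commute)
      then show ?thesis unfolding uminus_grassmann.rep_eq c if_not_P[OF False] by (simp only: if_False minus_zero)
    qed
  qed
qed


section \<open>Superfields\<close>

text \<open>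
  Superfields in the even coordinates \<open>x $ 1\<close>, \<open>x $ 2\<close> and the odd coordinates
  \<open>\<theta>\<^sup>1\<close>, \<open>\<theta>\<^sup>2\<close> are functions of \<open>x\<close> with values in the Grassmann algebra
  generated by \<open>\<theta>\<^sup>1\<close>, \<open>\<theta>\<^sup>2\<close> and the odd parameters \<open>'g\<close>; the value at \<open>x\<close> comprises the
  whole expansion in \<open>\<theta>\<^sup>1\<close> and \<open>\<theta>\<^sup>2\<close>.
\<close>

datatype 'g generator = Theta "2" | Param 'g

instantiation generator :: (linorder) linorder
begin

fun less_eq_generator :: "'a generator \<Rightarrow> 'a generator \<Rightarrow> bool" where
  "less_eq_generator (Theta i) (Theta j) = (i \<le> j)"
| "less_eq_generator (Theta i) (Param h) = True"
| "less_eq_generator (Param g) (Theta j) = False"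
| "less_eq_generator (Param g) (Param h) = (g \<le> h)"

definition less_generator :: "'a generator \<Rightarrow> 'a generator \<Rightarrow> bool" where
  "less_generator a b \<longleftrightarrow> a \<le> b \<and> \<not> b \<le> a"

instance
proof
  fix a b c :: "'a generator"
  show "a < b \<longleftrightarrow> a \<le> b \<and> \<not> b \<le> a" by (rule less_generator_def)
  show "a \<le> a" by (cases a) auto
  show "a \<le> b \<Longrightarrow> b \<le> c \<Longrightarrow> a \<le> c" by (cases a; cases b; cases c) auto
  show "a \<le> b \<Longrightarrow> b \<le> a \<Longrightarrow> a = b" by (cases a; cases b) auto
  show "a \<le> b \<or> b \<le> a" by (cases a; cases b) auto
qed

end

instance generator :: (finite) finite
proof
  have "x \<in> range Theta \<union> range Param" for x :: "'a generator"
    by (cases x) auto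
  then have "(UNIV :: 'a generator set) = range Theta \<union> range Param" by blast
  then show "finite (UNIV :: 'a generator set)"
    by (metis finite_Un finite_class.finite_UNIV finite_imageI)
qed

type_synonym 'g superfield = "real^2 \<Rightarrow> 'g generator grassmann"

definition partial :: "2 \<Rightarrow> (real^2 \<Rightarrow> complex) \<Rightarrow> real^2 \<Rightarrow> complex" where
  "partial j f x = frechet_derivative f (at x) (axis j 1)"

primrec C_k_on :: "nat \<Rightarrow> (real^2) set \<Rightarrow> (real^2 \<Rightarrow> complex) \<Rightarrow> bool" where
  "C_k_on 0 \<Omega> f \<longleftrightarrow> continuous_on \<Omega> f"
| "C_k_on (Suc k) \<Omega> f \<longleftrightarrow> f differentiable_on \<Omega> \<and> (\<forall>j. C_k_on k \<Omega> (partial j f))"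

definition smooth :: "(real^2) set \<Rightarrow> 'g superfield \<Rightarrow> bool" where
  "smooth \<Omega> f \<longleftrightarrow> (\<forall>S k. C_k_on k \<Omega> (\<lambda>x. coeff (f x) S))"

definition ddx :: "2 \<Rightarrow> 'g superfield \<Rightarrow> 'g superfield" where
  "ddx j f x = Grassmann (\<lambda>S. partial j (\<lambda>y. coeff (f y) S) x)"

definition cov :: "2 \<Rightarrow> 'g::{finite,linorder} superfield \<Rightarrow> 'g superfield" where
  "cov j f x = dgen (Theta j) (f x) - of_complex \<i> * gen (Theta j) * ddx j f x"

text \<open>
  The collection \<open>[u]\<close> at a point. Since \<open>D\<^sub>j\<^sup>2 = - \<i> \<partial>\<^sub>x\<^sub>j\<close>, every derivative of the
  dependent variables is obtained from iterated covariant derivatives and the odd coordinates.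
\<close>

type_synonym ('k, 'g) jet = "(real^2) \<times> ('k \<Rightarrow> 2 list \<Rightarrow> 'g generator grassmann)"

definition jet :: "('k \<Rightarrow> 'g::{finite,linorder} superfield) \<Rightarrow> real^2 \<Rightarrow> ('k, 'g) jet" where
  "jet u x = (x, \<lambda>k js. foldr cov js (u k) x)"

text \<open>The predicate \<open>odd_field\<close> tells which of the dependent variables are fermionic.\<close>

definition field_configs ::
    "(real^2) set \<Rightarrow> ('k \<Rightarrow> bool) \<Rightarrow> ('k \<Rightarrow> 'g superfield) set" where
  "field_configs \<Omega> odd_field = {u. \<forall>k. smooth \<Omega> (u k) \<and>
     (\<forall>x\<in>\<Omega>. if odd_field k then fermionic (u k x) else bosonic (u k x))}"

definition solutions ::
    "(real^2) set \<Rightarrow> ('k \<Rightarrow> bool) \<Rightarrow> ('l \<Rightarrow> ('k, 'g) jet \<Rightarrow> 'g generator grassmann) \<Rightarrow>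
     ('k \<Rightarrow> 'g::{finite,linorder} superfield) set" where
  "solutions \<Omega> odd_field \<Delta> = {u \<in> field_configs \<Omega> odd_field. \<forall>l. \<forall>x\<in>\<Omega>. \<Delta> l (jet u x) = 0}"


section \<open>Supermatrices\<close>

type_synonym ('p, 'q, 'g) supermatrix = "('g generator grassmann)^('p + 'q)^('p + 'q)"
type_synonym ('p, 'q, 'g) matrix_field = "real^2 \<Rightarrow> ('p, 'q, 'g) supermatrix"

definition bosonic_mat :: "('p::finite, 'q::finite, 'g) supermatrix \<Rightarrow> bool" where
  "bosonic_mat M \<longleftrightarrow>
     (\<forall>i j. if isl i = isl j then bosonic (M $ i $ j) else fermionic (M $ i $ j))"

definition fermionic_mat :: "('p::finite, 'q::finite, 'g) supermatrix \<Rightarrow> bool" where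
  "fermionic_mat M \<longleftrightarrow>
     (\<forall>i j. if isl i = isl j then fermionic (M $ i $ j) else bosonic (M $ i $ j))"

definition GL :: "('p::finite, 'q::finite, 'g::{finite,linorder}) supermatrix set" where
  "GL = {M. bosonic_mat M \<and> invertible M}"

definition E :: "('p::finite, 'q::finite, 'g::{finite,linorder}) supermatrix" where
  "E = (\<chi> i j. if i = j then if isl i then 1 else - 1 else 0)"

definition scale_mat :: "'g generator grassmann \<Rightarrow>
    ('p::finite, 'q::finite, 'g::{finite,linorder}) supermatrix \<Rightarrow> ('p, 'q, 'g) supermatrix" where
  "scale_mat c M = (\<chi> i j. c * M $ i $ j)"

definition comm_mat :: "('p::finite, 'q::finite, 'g::{finite,linorder}) supermatrix \<Rightarrow>
    ('p, 'q, 'g) supermatrix \<Rightarrow> ('p, 'q, 'g) supermatrix" where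
  "comm_mat M N = M ** N - N ** M"

definition anticomm_mat :: "('p::finite, 'q::finite, 'g::{finite,linorder}) supermatrix \<Rightarrow>
    ('p, 'q, 'g) supermatrix \<Rightarrow> ('p, 'q, 'g) supermatrix" where
  "anticomm_mat M N = M ** N + N ** M"

definition smooth_mat :: "(real^2) set \<Rightarrow> ('p::finite, 'q::finite, 'g) matrix_field \<Rightarrow> bool" where
  "smooth_mat \<Omega> M \<longleftrightarrow> (\<forall>i j. smooth \<Omega> (\<lambda>x. M x $ i $ j))"

definition bosonic_field :: "(real^2) set \<Rightarrow> ('p::finite, 'q::finite, 'g) matrix_field \<Rightarrow> bool" where
  "bosonic_field \<Omega> M \<longleftrightarrow> smooth_mat \<Omega> M \<and> (\<forall>x\<in>\<Omega>. bosonic_mat (M x))"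

definition fermionic_field :: "(real^2) set \<Rightarrow> ('p::finite, 'q::finite, 'g) matrix_field \<Rightarrow> bool" where
  "fermionic_field \<Omega> M \<longleftrightarrow> smooth_mat \<Omega> M \<and> (\<forall>x\<in>\<Omega>. fermionic_mat (M x))"

definition GL_field ::
    "(real^2) set \<Rightarrow> ('p::finite, 'q::finite, 'g::{finite,linorder}) matrix_field \<Rightarrow> bool" where
  "GL_field \<Omega> M \<longleftrightarrow> smooth_mat \<Omega> M \<and> (\<forall>x\<in>\<Omega>. M x \<in> GL)"

definition cov_mat :: "2 \<Rightarrow> ('p::finite, 'q::finite, 'g::{finite,linorder}) matrix_field \<Rightarrow>
    ('p, 'q, 'g) matrix_field" where
  "cov_mat n M x = (\<chi> i j. cov n (\<lambda>y. M y $ i $ j) x)"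


section \<open>Linear spectral problem, deformations and surfaces\<close>

definition LSP :: "(real^2) set \<Rightarrow> (2 \<Rightarrow> ('p::finite, 'q::finite, 'g::{finite,linorder}) matrix_field) \<Rightarrow>
    ('p, 'q, 'g) matrix_field \<Rightarrow> bool" where
  "LSP \<Omega> U \<Psi> \<longleftrightarrow> (\<forall>j. \<forall>x\<in>\<Omega>. cov_mat j \<Psi> x - U j x ** \<Psi> x = 0)"

definition ZCC ::
    "(real^2) set \<Rightarrow> (2 \<Rightarrow> ('p::finite, 'q::finite, 'g::{finite,linorder}) matrix_field) \<Rightarrow> bool" where
  "ZCC \<Omega> U \<longleftrightarrow> (\<forall>x\<in>\<Omega>. cov_mat 1 (U 2) x + cov_mat 2 (U 1) x
     - anticomm_mat (E ** U 1 x) (E ** U 2 x) = 0)"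

definition deformed_ZCC :: "(real^2) set \<Rightarrow>
    (2 \<Rightarrow> ('p::finite, 'q::finite, 'g::{finite,linorder}) matrix_field) \<Rightarrow>
    (2 \<Rightarrow> ('p, 'q, 'g) matrix_field) \<Rightarrow> bool" where
  "deformed_ZCC \<Omega> U A \<longleftrightarrow> (\<forall>x\<in>\<Omega>. cov_mat 1 (A 2) x + cov_mat 2 (A 1) x
     + comm_mat (E ** A 1 x) (E ** U 2 x) + comm_mat (E ** A 2 x) (E ** U 1 x) = 0)"

definition fermionic_parameter :: "'g::linorder generator grassmann \<Rightarrow> bool" where
  "fermionic_parameter \<epsilon> \<longleftrightarrow> fermionic \<epsilon> \<and> (\<forall>j. dgen (Theta j) \<epsilon> = 0)"

definition deformed_U :: "'g generator grassmann \<Rightarrow>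
    ('p::finite, 'q::finite, 'g::{finite,linorder}) matrix_field \<Rightarrow>
    ('p, 'q, 'g) matrix_field \<Rightarrow> ('p, 'q, 'g) matrix_field" where
  "deformed_U \<epsilon> U A x = U x + scale_mat \<epsilon> (E ** A x)"

definition deformed_\<Psi> :: "'g generator grassmann \<Rightarrow>
    ('p::finite, 'q::finite, 'g::{finite,linorder}) matrix_field \<Rightarrow>
    ('p, 'q, 'g) matrix_field \<Rightarrow> ('p, 'q, 'g) matrix_field" where
  "deformed_\<Psi> \<epsilon> \<Psi> F x = \<Psi> x ** (mat 1 + scale_mat \<epsilon> (E ** F x))"

text \<open>Linear independence is meant over the Grassmann algebra, point by point.\<close>

definition lin_independent ::
    "(2 \<Rightarrow> ('p::finite, 'q::finite, 'g::{finite,linorder}) supermatrix) \<Rightarrow> bool" where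
  "lin_independent T \<longleftrightarrow> (\<forall>c. (\<Sum>j\<in>UNIV. scale_mat (c j) (T j)) = 0 \<longrightarrow> (\<forall>j. c j = 0))"

definition tangent_vector :: "('p::finite, 'q::finite, 'g::{finite,linorder}) matrix_field \<Rightarrow>
    2 \<Rightarrow> ('p, 'q, 'g) matrix_field" where
  "tangent_vector F j x = E ** cov_mat j F x"

definition immersed_surface ::
    "(real^2) set \<Rightarrow> ('p::finite, 'q::finite, 'g::{finite,linorder}) matrix_field \<Rightarrow> bool" where
  "immersed_surface \<Omega> F \<longleftrightarrow>
     fermionic_field \<Omega> F \<and> (\<forall>x\<in>\<Omega>. lin_independent (\<lambda>j. tangent_vector F j x))"

end

theory Submission
  imports Defs "HOL-Complex_Analysis.Riemann_Mapping"
begin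

text \<open>
  The tangent equations say \<open>D\<^sub>j F = B\<^sub>j\<close> with \<open>B\<^sub>j = - E \<Psi>\<^sup>-\<^sup>1 E A\<^sub>j \<Psi>\<close>. The LSP gives
  \<open>D\<^sub>j \<Psi>\<^sup>-\<^sup>1 = - E \<Psi>\<^sup>-\<^sup>1 E U\<^sub>j\<close>, so by the graded Leibniz rule \<open>D\<^sub>1 B\<^sub>2 + D\<^sub>2 B\<^sub>1\<close> is the left-hand side of the
  deformed ZCC conjugated by \<open>\<Psi>\<close>, up to sign, and vanishes. In the expansion of \<open>F\<close> in \<open>\<theta>\<^sup>1\<close>, \<open>\<theta>\<^sup>2\<close>
  the equations determine every coefficient except the one free of both, whose two partial
  derivatives are prescribed; compatibility says that this 1-form is closed, hence exact on a
  simply connected domain: a Riemann map pulls it back to a disc, where a radial integral is a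
  primitive. The deformed LSP follows because the term of second order in \<open>\<epsilon>\<close> contains \<open>\<epsilon>\<^sup>2 = 0\<close>.
\<close>

section \<open>Smooth functions of two real variables\<close>

text \<open>All signs are carried by the parity automorphism, taken entrywise on supermatrices. An
  odd derivative or an odd scalar passes a supermatrix at the price of this automorphism, and on an
  even supermatrix it is conjugation by \<open>E\<close>. This is where the factors \<open>E\<close>
  in the formulas come from, and it reduces the compatibility computation to associative matrix
  algebra with \<open>E ** E = mat 1\<close>. Two difficulties are hidden in the integration. The
  inverse of \<open>\<Psi>\<close> is given point by point and its entries do not commute, so its
  smoothness needs a detour through complex matrices, and its parity rests on the uniqueness of
  inverses. Moreover the prescribed derivatives leave a constant of integration in every coefficient
  of F free of both odd coordinates; the constants have to be chosen so that F becomes odd, which is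
  achieved by taking zero for the coefficients of the wrong parity.\<close>

lemma differentiable_at_of_on:
  "open \<Omega> \<Longrightarrow> f differentiable_on \<Omega> \<Longrightarrow> x \<in> \<Omega> \<Longrightarrow> f differentiable (at x)"
  by (simp add: differentiable_on_eq_differentiable_at)

text \<open>The possible derivatives of f and g at x coincide, so \<open>frechet_derivative\<close>
  chooses by the same predicate; this also covers points where no derivative exists.\<close>

lemma partial_cong:
  assumes "open \<Omega>" "x \<in> \<Omega>" "\<And>y. y \<in> \<Omega> \<Longrightarrow> f y = g y"
  shows "partial j f x = partial j g x"
proof -
  have "(f has_derivative D) (at x) \<longleftrightarrow> (g has_derivative D) (at x)" for D
    using has_derivative_transform_within_open[OF _ assms(1,2), of f D UNIV g]
      has_derivative_transform_within_open[OF _ assms(1,2), of g D UNIV f] assms(3) by auto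
  then show ?thesis
    unfolding partial_def frechet_derivative_def by presburger
qed

lemma C_k_on_cong:
  assumes "open \<Omega>" "\<And>y. y \<in> \<Omega> \<Longrightarrow> f y = g y"
  shows "C_k_on k \<Omega> f \<longleftrightarrow> C_k_on k \<Omega> g"
  using assms(2)
proof (induction k arbitrary: f g)
  case 0
  then show ?case by (simp cong: continuous_on_cong)
next
  case (Suc k)
  have "h differentiable_on \<Omega>" if "h' differentiable_on \<Omega>" "\<And>y. y \<in> \<Omega> \<Longrightarrow> h' y = h y"
    for h h' :: "real^2 \<Rightarrow> complex"
    using that unfolding differentiable_on_def
    by (auto intro: differentiable_transform_within[OF _ zero_less_one])
  then have "f differentiable_on \<Omega> \<longleftrightarrow> g differentiable_on \<Omega>"
    using Suc.prems by metis
  moreover have "C_k_on k \<Omega> (partial j f) \<longleftrightarrow> C_k_on k \<Omega> (partial j g)" for j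
    by (intro Suc.IH partial_cong[OF assms(1)]) (use Suc.prems in auto)
  ultimately show ?case by simp
qed

lemma C_k_on_SucD: "C_k_on (Suc k) \<Omega> f \<Longrightarrow> C_k_on k \<Omega> f"
  by (induction k arbitrary: f) (auto intro: differentiable_imp_continuous_on)

lemma partial_eq_derivative: "(f has_derivative D) (at x) \<Longrightarrow> partial j f x = D (axis j 1)"
  by (simp add: partial_def frechet_derivative_at[symmetric])

lemma has_derivative_frechet: "f differentiable (at x) \<Longrightarrow> (f has_derivative frechet_derivative f (at x)) (at x)"
  by (rule frechet_derivative_works[THEN iffD1])

lemma partial_const [simp]: "partial j (\<lambda>x. c) = (\<lambda>x. 0)"
  by (rule ext) (rule partial_eq_derivative[OF has_derivative_const])

lemma partial_add:
  assumes "f differentiable (at x)" "g differentiable (at x)"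
  shows "partial j (\<lambda>x. f x + g x) x = partial j f x + partial j g x"
  using partial_eq_derivative[OF has_derivative_add[OF assms[THEN has_derivative_frechet]], of j]
  by (simp add: partial_def)

lemma partial_mult:
  assumes "f differentiable (at x)" "g differentiable (at x)"
  shows "partial j (\<lambda>x. f x * g x) x = partial j f x * g x + f x * partial j g x"
  using partial_eq_derivative[OF has_derivative_mult[OF assms[THEN has_derivative_frechet]], of j]
  by (simp add: partial_def)

lemma partial_inverse:
  assumes "f differentiable (at x)" "f x \<noteq> 0"
  shows "partial j (\<lambda>x. inverse (f x)) x = (- 1) * partial j f x * (inverse (f x) * inverse (f x))"
  using partial_eq_derivative[OF Deriv.has_derivative_inverse[OF assms(2) assms(1)[THEN has_derivative_frechet]], of j]
  by (simp add: partial_def)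

lemma C_k_on_const: "C_k_on k \<Omega> (\<lambda>x. c)"
  by (induction k arbitrary: c) auto

text \<open>\<open>partial j f\<close> is a total function with unspecified values where f is not
  differentiable, so rules such as the product rule hold on \<open>\<Omega>\<close> only. This rule
  lets such a formula stand in for \<open>partial j f\<close>.\<close>

lemma C_k_on_SucI:
  assumes "open \<Omega>" "f differentiable_on \<Omega>" "\<And>j. C_k_on k \<Omega> (g j)"
    and "\<And>j x. x \<in> \<Omega> \<Longrightarrow> partial j f x = g j x"
  shows "C_k_on (Suc k) \<Omega> f"
proof -
  have "C_k_on k \<Omega> (partial j f)" for j
    using C_k_on_cong[OF assms(1), of "partial j f" "g j" k] assms(3,4) by blast
  then show ?thesis using assms(2) by simp
qed

lemma C_k_on_add:
  assumes "open \<Omega>"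
  shows "C_k_on k \<Omega> f \<Longrightarrow> C_k_on k \<Omega> g \<Longrightarrow> C_k_on k \<Omega> (\<lambda>x. f x + g x)"
proof (induction k arbitrary: f g)
  case (Suc k)
  then have fg: "f differentiable_on \<Omega>" "g differentiable_on \<Omega>"
    "C_k_on k \<Omega> (partial j f)" "C_k_on k \<Omega> (partial j g)" for j by auto
  show ?case
  proof (rule C_k_on_SucI[OF assms, where g = "\<lambda>j x. partial j f x + partial j g x"])
    show "partial j (\<lambda>x. f x + g x) x = partial j f x + partial j g x" if "x \<in> \<Omega>" for j x
      using fg(1,2)[THEN differentiable_at_of_on[OF assms _ that]] by (rule partial_add)
  qed (rule differentiable_on_add Suc.IH fg)+
qed (auto intro: continuous_on_add)

lemma C_k_on_mult:
  assumes "open \<Omega>"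
  shows "C_k_on k \<Omega> f \<Longrightarrow> C_k_on k \<Omega> g \<Longrightarrow> C_k_on k \<Omega> (\<lambda>x. f x * g x)"
proof (induction k arbitrary: f g)
  case (Suc k)
  then have fg: "f differentiable_on \<Omega>" "g differentiable_on \<Omega>"
    "C_k_on k \<Omega> (partial j f)" "C_k_on k \<Omega> (partial j g)" for j by auto
  show ?case
  proof (rule C_k_on_SucI[OF assms, where g = "\<lambda>j x. partial j f x * g x + f x * partial j g x"])
    show "partial j (\<lambda>x. f x * g x) x = partial j f x * g x + f x * partial j g x" if "x \<in> \<Omega>" for j x
      using fg(1,2)[THEN differentiable_at_of_on[OF assms _ that]] by (rule partial_mult)
  qed (rule differentiable_on_mult C_k_on_add[OF assms] Suc.IH fg Suc.prems[THEN C_k_on_SucD])+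
qed (auto intro: continuous_on_mult)

lemma C_k_on_inverse:
  assumes "open \<Omega>" "\<And>x. x \<in> \<Omega> \<Longrightarrow> f x \<noteq> 0"
  shows "C_k_on k \<Omega> f \<Longrightarrow> C_k_on k \<Omega> (\<lambda>x. inverse (f x))"
proof (induction k)
  case (Suc k)
  then have f: "f differentiable_on \<Omega>" "C_k_on k \<Omega> (partial j f)" for j by auto
  show ?case
  proof (rule C_k_on_SucI[OF assms(1), where
        g = "\<lambda>j x. (- 1) * partial j f x * (inverse (f x) * inverse (f x))"])
    show "partial j (\<lambda>x. inverse (f x)) x = (- 1) * partial j f x * (inverse (f x) * inverse (f x))"
      if "x \<in> \<Omega>" for j x
      using differentiable_at_of_on[OF assms(1) f(1) that] assms(2)[OF that] by (rule partial_inverse)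
    show "(\<lambda>x. inverse (f x)) differentiable_on \<Omega>"
      using f(1) assms(2) by (rule differentiable_on_inverse)
    show "C_k_on k \<Omega> (\<lambda>x. (- 1) * partial j f x * (inverse (f x) * inverse (f x)))" for j
      by (intro C_k_on_mult[OF assms(1)] C_k_on_const f Suc.IH Suc.prems[THEN C_k_on_SucD])
  qed
qed (auto intro!: continuous_on_inverse assms(2))

text \<open>Requiring all orders at once gives a class closed under \<open>partial\<close>, which no
  fixed finite order does.\<close>

definition smooth_fun :: "(real^2) set \<Rightarrow> (real^2 \<Rightarrow> complex) \<Rightarrow> bool" where
  "smooth_fun \<Omega> f \<longleftrightarrow> (\<forall>k. C_k_on k \<Omega> f)"

lemma smooth_iff: "smooth \<Omega> f \<longleftrightarrow> (\<forall>S. smooth_fun \<Omega> (\<lambda>x. coeff (f x) S))"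
  by (auto simp: smooth_def smooth_fun_def)

lemma smooth_fun_cong:
  assumes "open \<Omega>" "\<And>y. y \<in> \<Omega> \<Longrightarrow> f y = g y"
  shows "smooth_fun \<Omega> f \<longleftrightarrow> smooth_fun \<Omega> g"
  using C_k_on_cong[OF assms] by (simp add: smooth_fun_def)

lemma smooth_fun_differentiable:
  "open \<Omega> \<Longrightarrow> smooth_fun \<Omega> f \<Longrightarrow> x \<in> \<Omega> \<Longrightarrow> f differentiable (at x)"
  unfolding smooth_fun_def using differentiable_at_of_on C_k_on.simps(2) by blast

lemma smooth_fun_partial: "smooth_fun \<Omega> f \<Longrightarrow> smooth_fun \<Omega> (partial j f)"
  unfolding smooth_fun_def using C_k_on.simps(2) by blast

lemma smooth_funI_partial:
  assumes "f differentiable_on \<Omega>" "\<And>j. smooth_fun \<Omega> (partial j f)"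
  shows "smooth_fun \<Omega> f"
  unfolding smooth_fun_def
proof
  fix k show "C_k_on k \<Omega> f"
    \<comment> \<open>Order k follows from order k + 1, which unfolds to the two hypotheses; no
      induction is involved.\<close>
    using assms by (rule_tac C_k_on_SucD) (simp add: smooth_fun_def)
qed

lemma smooth_fun_const: "smooth_fun \<Omega> (\<lambda>x. c)"
  by (simp add: smooth_fun_def C_k_on_const)

lemma smooth_fun_add: "open \<Omega> \<Longrightarrow> smooth_fun \<Omega> f \<Longrightarrow> smooth_fun \<Omega> g \<Longrightarrow> smooth_fun \<Omega> (\<lambda>x. f x + g x)"
  by (simp add: smooth_fun_def C_k_on_add)

lemma smooth_fun_mult: "open \<Omega> \<Longrightarrow> smooth_fun \<Omega> f \<Longrightarrow> smooth_fun \<Omega> g \<Longrightarrow> smooth_fun \<Omega> (\<lambda>x. f x * g x)"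
  by (simp add: smooth_fun_def C_k_on_mult)

lemma smooth_fun_sum:
  "open \<Omega> \<Longrightarrow> (\<And>i. i \<in> I \<Longrightarrow> smooth_fun \<Omega> (f i)) \<Longrightarrow> smooth_fun \<Omega> (\<lambda>x. \<Sum>i\<in>I. f i x)"
  by (induction I rule: infinite_finite_induct) (auto intro: smooth_fun_const smooth_fun_add)

lemma smooth_fun_prod:
  "open \<Omega> \<Longrightarrow> (\<And>i. i \<in> I \<Longrightarrow> smooth_fun \<Omega> (f i)) \<Longrightarrow> smooth_fun \<Omega> (\<lambda>x. \<Prod>i\<in>I. f i x)"
  by (induction I rule: infinite_finite_induct) (auto intro: smooth_fun_const smooth_fun_mult)

lemma smooth_fun_divide:
  assumes "open \<Omega>" "smooth_fun \<Omega> f" "smooth_fun \<Omega> g" "\<And>x. x \<in> \<Omega> \<Longrightarrow> g x \<noteq> 0"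
  shows "smooth_fun \<Omega> (\<lambda>x. f x / g x)"
  using C_k_on_mult[OF assms(1) _ C_k_on_inverse[OF assms(1,4)]] assms(2,3)
  by (auto simp: divide_inverse smooth_fun_def)

text \<open>The determinant is a polynomial in the entries; this is what makes Cramer's rule yield
  smooth inverses in \<open>smooth_mat_inverse\<close>.\<close>

lemma smooth_fun_det:
  fixes M :: "real^2 \<Rightarrow> complex^'n^'n"
  assumes "open \<Omega>" "\<And>i j. smooth_fun \<Omega> (\<lambda>x. M x $ i $ j)"
  shows "smooth_fun \<Omega> (\<lambda>x. det (M x))"
  unfolding det_def using assms
  by (intro smooth_fun_sum smooth_fun_mult smooth_fun_prod smooth_fun_const)

lemma partial_cmult:
  assumes "f differentiable (at x)"
  shows "partial j (\<lambda>x. c * f x) x = c * partial j f x"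
  using partial_mult[OF differentiable_const assms] by simp

lemma partial_sum:
  assumes "finite I" "\<And>i. i \<in> I \<Longrightarrow> f i differentiable (at x)"
  shows "partial j (\<lambda>x. \<Sum>i\<in>I. f i x) x = (\<Sum>i\<in>I. partial j (f i) x)"
  using assms
proof (induction I rule: finite_induct)
  case (insert i I)
  have "partial j (\<lambda>x. f i x + (\<Sum>i\<in>I. f i x)) x = partial j (f i) x + (\<Sum>i\<in>I. partial j (f i) x)"
    using insert by (subst partial_add) (auto intro: differentiable_sum)
  then show ?case using insert.hyps by simp
qed simp

section \<open>Closed forms on simply connected plane domains\<close>

text \<open>\<open>\<omega>' x u\<close> is the derivative of the 1-form at x in direction u, so its
  symmetry is the equation d \<omega> = 0 free of coordinates, and pullback becomes a chain rule.
  Joint continuity in x and u is the form of continuous differentiability that suits differentiation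
  under the integral sign.\<close>

definition closed_form ::
    "'a::real_normed_vector set \<Rightarrow> ('a \<Rightarrow> 'a \<Rightarrow>\<^sub>L 'b::real_normed_vector) \<Rightarrow> ('a \<Rightarrow> 'a \<Rightarrow> 'a \<Rightarrow>\<^sub>L 'b) \<Rightarrow> bool" where
  "closed_form S \<omega> \<omega>' \<longleftrightarrow>
     (\<forall>x\<in>S. (\<omega> has_derivative \<omega>' x) (at x)) \<and>
     (\<forall>x\<in>S. \<forall>u v. \<omega>' x u v = \<omega>' x v u) \<and>
     continuous_on (S \<times> UNIV) (\<lambda>(x, u). \<omega>' x u)"

definition exact_form ::
    "'a::real_normed_vector set \<Rightarrow> ('a \<Rightarrow> 'a \<Rightarrow>\<^sub>L 'b::real_normed_vector) \<Rightarrow> bool" where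
  "exact_form S \<omega> \<longleftrightarrow> (\<exists>f. \<forall>x\<in>S. (f has_derivative blinfun_apply (\<omega> x)) (at x))"

lemma closed_form_continuous_on:
  assumes "closed_form S \<omega> \<omega>'"
  shows "continuous_on S \<omega>"
  using assms unfolding closed_form_def
  by (meson continuous_at_imp_continuous_on has_derivative_continuous)

lemma closed_form_continuous_compose:
  assumes "closed_form S \<omega> \<omega>'" "continuous_on T f" "continuous_on T g" "\<And>t. t \<in> T \<Longrightarrow> f t \<in> S"
  shows "continuous_on T (\<lambda>t. \<omega>' (f t) (g t))"
proof -
  have "continuous_on (S \<times> UNIV) (\<lambda>(x, u). \<omega>' x u)"
    using assms(1) by (simp add: closed_form_def)
  from continuous_on_compose2[OF this continuous_on_Pair[OF assms(2,3)]] assms(4)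
  show ?thesis by auto
qed

text \<open>The derivative \<open>\<phi>'\<close> is treated as a closed vector-valued form: its
  closedness is the symmetry of the second derivatives of \<open>\<phi>\<close>. The product rule
  gives two terms, the first symmetric by that of \<open>\<phi>''\<close>, the second by that of
  \<open>\<omega>'\<close>.\<close>

lemma closed_form_pullback:
  assumes \<omega>: "closed_form T \<omega> \<omega>'" and \<phi>': "closed_form S \<phi>' \<phi>''"
    and \<phi>: "\<And>x. x \<in> S \<Longrightarrow> (\<phi> has_derivative blinfun_apply (\<phi>' x)) (at x)"
    and ST: "\<And>x. x \<in> S \<Longrightarrow> \<phi> x \<in> T"
  shows "closed_form S (\<lambda>x. \<omega> (\<phi> x) o\<^sub>L \<phi>' x)
    (\<lambda>x u. (\<omega> (\<phi> x) o\<^sub>L \<phi>'' x u) + (\<omega>' (\<phi> x) (\<phi>' x u) o\<^sub>L \<phi>' x))"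
  unfolding closed_form_def
proof (intro conjI ballI allI)
  fix x assume x: "x \<in> S"
  have 1: "((\<lambda>x. \<omega> (\<phi> x)) has_derivative (\<lambda>u. \<omega>' (\<phi> x) (\<phi>' x u))) (at x)"
    using has_derivative_compose[OF \<phi>[OF x], of \<omega> "\<omega>' (\<phi> x)"] \<omega> ST[OF x]
    by (auto simp: closed_form_def)
  have 2: "(\<phi>' has_derivative \<phi>'' x) (at x)"
    using \<phi>' x by (auto simp: closed_form_def)
  show "((\<lambda>x. \<omega> (\<phi> x) o\<^sub>L \<phi>' x) has_derivative
      (\<lambda>u. (\<omega> (\<phi> x) o\<^sub>L \<phi>'' x u) + (\<omega>' (\<phi> x) (\<phi>' x u) o\<^sub>L \<phi>' x))) (at x)"
    using bounded_bilinear.FDERIV[OF bounded_bilinear_blinfun_compose 1 2] by simp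
  show "((\<omega> (\<phi> x) o\<^sub>L \<phi>'' x u) + (\<omega>' (\<phi> x) (\<phi>' x u) o\<^sub>L \<phi>' x)) v =
      ((\<omega> (\<phi> x) o\<^sub>L \<phi>'' x v) + (\<omega>' (\<phi> x) (\<phi>' x v) o\<^sub>L \<phi>' x)) u" for u v
  proof -
    have "\<omega>' (\<phi> x) (\<phi>' x u) (\<phi>' x v) = \<omega>' (\<phi> x) (\<phi>' x v) (\<phi>' x u)" "\<phi>'' x u v = \<phi>'' x v u"
      using \<omega> \<phi>' ST[OF x] x unfolding closed_form_def by blast+
    then show ?thesis by (simp add: blinfun.add_left)
  qed
next
  have c\<phi>: "continuous_on S \<phi>"
    using \<phi> by (meson continuous_at_imp_continuous_on has_derivative_continuous)
  have c1: "continuous_on (S \<times> UNIV) (\<lambda>p. \<phi> (fst p))"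
    by (rule continuous_on_compose2[OF c\<phi> continuous_on_fst]) (auto intro: continuous_on_id)
  have c2: "continuous_on (S \<times> UNIV) (\<lambda>p. \<phi>' (fst p))"
    by (rule continuous_on_compose2[OF closed_form_continuous_on[OF \<phi>'] continuous_on_fst]) (auto intro: continuous_on_id)
  have c3: "continuous_on (S \<times> UNIV) (\<lambda>p. \<omega> (\<phi> (fst p)))"
    by (rule continuous_on_compose2[OF closed_form_continuous_on[OF \<omega>] c1]) (auto intro: ST)
  have c4: "continuous_on (S \<times> UNIV) (\<lambda>p. \<phi>'' (fst p) (snd p))"
    by (rule closed_form_continuous_compose[OF \<phi>']) (auto intro!: continuous_intros)
  have c5: "continuous_on (S \<times> UNIV) (\<lambda>p. \<omega>' (\<phi> (fst p)) (\<phi>' (fst p) (snd p)))"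
    by (rule closed_form_continuous_compose[OF \<omega> c1])
      (auto intro!: blinfun.continuous_on c2 continuous_intros ST)
  show "continuous_on (S \<times> UNIV)
      (\<lambda>(x, u). (\<omega> (\<phi> x) o\<^sub>L \<phi>'' x u) + (\<omega>' (\<phi> x) (\<phi>' x u) o\<^sub>L \<phi>' x))"
    unfolding case_prod_unfold
    by (intro continuous_on_add bounded_bilinear.continuous_on[OF bounded_bilinear_blinfun_compose] c2 c3 c4 c5)
qed

lemma exact_form_of_pullback:
  assumes "exact_form S (\<lambda>x. \<omega> (\<phi> x) o\<^sub>L \<phi>' x)" "open T"
    and \<phi>: "\<And>x. x \<in> S \<Longrightarrow> (\<phi> has_derivative blinfun_apply (\<phi>' x)) (at x)"
    and \<psi>: "\<And>y. y \<in> T \<Longrightarrow> \<psi> y \<in> S \<and> \<phi> (\<psi> y) = y \<and> \<psi> differentiable (at y)"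
  shows "exact_form T \<omega>"
proof -
  obtain f where f: "\<And>x. x \<in> S \<Longrightarrow> (f has_derivative blinfun_apply (\<omega> (\<phi> x) o\<^sub>L \<phi>' x)) (at x)"
    using assms(1) unfolding exact_form_def by blast
  have "((\<lambda>y. f (\<psi> y)) has_derivative blinfun_apply (\<omega> y)) (at y)" if y: "y \<in> T" for y
  proof -
    obtain D where D: "(\<psi> has_derivative D) (at y)"
      using \<psi>[OF y] by (auto simp: differentiable_def)
    have "((\<lambda>y. \<phi> (\<psi> y)) has_derivative (\<lambda>v. \<phi>' (\<psi> y) (D v))) (at y)"
      using has_derivative_compose[OF D] \<phi> \<psi>[OF y] by blast
    then have "((\<lambda>y. y) has_derivative (\<lambda>v. \<phi>' (\<psi> y) (D v))) (at y)"
      by (rule has_derivative_transform_within_open[OF _ \<open>open T\<close> y]) (use \<psi> in auto)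
    \<comment> \<open>Differentiating \<open>\<phi> (\<psi> y) = y\<close> shows that D is a right
      inverse of \<open>\<phi>' (\<psi> y)\<close>; it cancels the derivative introduced by the
      pullback.\<close>
    then have id: "(\<lambda>v. \<phi>' (\<psi> y) (D v)) = (\<lambda>v. v)"
      using has_derivative_unique has_derivative_ident by blast
    have "((\<lambda>y. f (\<psi> y)) has_derivative (\<lambda>v. (\<omega> (\<phi> (\<psi> y)) o\<^sub>L \<phi>' (\<psi> y)) (D v))) (at y)"
      using has_derivative_compose[OF D] f \<psi>[OF y] by blast
    moreover have "(\<lambda>v. (\<omega> (\<phi> (\<psi> y)) o\<^sub>L \<phi>' (\<psi> y)) (D v)) = blinfun_apply (\<omega> y)"
      using fun_cong[OF id] \<psi>[OF y] by (simp add: fun_eq_iff)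
    ultimately show ?thesis by simp
  qed
  then show ?thesis unfolding exact_form_def by blast
qed

lemma exact_form_convex:
  fixes \<omega> :: "'a::euclidean_space \<Rightarrow> 'a \<Rightarrow>\<^sub>L 'b::banach"
  assumes \<omega>: "closed_form S \<omega> \<omega>'" and S: "open S" "convex S" "0 \<in> S"
  shows "exact_form S \<omega>"
proof -
  have star: "t *\<^sub>R x \<in> S" if "x \<in> S" "t \<in> {0..1}" for x t
    using convexD_alt[OF S(2,3) that(1), of t] that(2) by simp
  note c\<omega> = closed_form_continuous_on[OF \<omega>]
  \<comment> \<open>\<open>\<omega>'\<close> is a bare function of its direction argument; its
    linearity comes from being a derivative.\<close>
  have \<omega>'_mult: "\<omega>' (t *\<^sub>R x) (r *\<^sub>R u) = r *\<^sub>R \<omega>' (t *\<^sub>R x) u" if "x \<in> S" "t \<in> {0..1}" for x t r u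
  proof -
    have "(\<omega> has_derivative \<omega>' (t *\<^sub>R x)) (at (t *\<^sub>R x))"
      using \<omega> star[OF that] by (simp add: closed_form_def)
    from linear_simps(5)[OF has_derivative_bounded_linear[OF this]] show ?thesis .
  qed
  define f where "f x = integral (cbox 0 1) (\<lambda>t. \<omega> (t *\<^sub>R x) x)" for x
  \<comment> \<open>\<open>fx x t\<close> has two readings: it is the t-derivative of t \<omega>(t
    x), and by closedness it is the x-derivative of the integrand of f. Its integral over t is
    therefore both \<open>\<omega> x\<close> and the derivative of f.\<close>
  define fx where "fx x t = t *\<^sub>R \<omega>' (t *\<^sub>R x) x + \<omega> (t *\<^sub>R x)" for x and t :: real
  have c_line: "continuous_on {0..1} (\<lambda>t. \<omega> (t *\<^sub>R x))" if "x \<in> S" for x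
    by (rule continuous_on_compose2[OF c\<omega>]) (auto intro!: continuous_intros star that)
  have int: "(fx x has_integral \<omega> x) (cbox 0 1)" if x: "x \<in> S" for x
  proof -
    have "((\<lambda>t. t *\<^sub>R \<omega> (t *\<^sub>R x)) has_vector_derivative fx x t) (at t within {0..1})"
      if t: "t \<in> {0..1}" for t
    proof -
      have "((\<lambda>t. t *\<^sub>R x) has_derivative (\<lambda>h. h *\<^sub>R x)) (at t within {0..1})"
        by (auto intro!: derivative_eq_intros)
      moreover have "(\<omega> has_derivative \<omega>' (t *\<^sub>R x)) (at (t *\<^sub>R x))"
        using \<omega> star[OF x t] by (auto simp: closed_form_def)
      ultimately have "((\<lambda>t. \<omega> (t *\<^sub>R x)) has_derivative (\<lambda>h. \<omega>' (t *\<^sub>R x) (h *\<^sub>R x))) (at t within {0..1})"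
        by (rule has_derivative_compose)
      then have "((\<lambda>t. \<omega> (t *\<^sub>R x)) has_vector_derivative \<omega>' (t *\<^sub>R x) x) (at t within {0..1})"
        by (simp add: has_vector_derivative_def \<omega>'_mult[OF x t])
      from has_vector_derivative_scaleR[OF DERIV_ident this]
      show ?thesis by (simp add: fx_def)
    qed
    from fundamental_theorem_of_calculus[OF zero_le_one this]
    show ?thesis by simp
  qed
  have "(f has_derivative blinfun_apply (\<omega> x)) (at x)" if x: "x \<in> S" for x
  proof -
    have "(f has_derivative integral (cbox 0 1) (fx x)) (at x within S)"
      unfolding f_def
    proof (rule leibniz_rule[OF _ _ _ x S(2)])
      fix y t assume y: "y \<in> S" and t: "t \<in> cbox 0 (1::real)"
      then have t': "t \<in> {0..1}" by simp
      have 1: "((\<lambda>y. t *\<^sub>R y) has_derivative (\<lambda>h. t *\<^sub>R h)) (at y within S)"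
        by (auto intro!: derivative_eq_intros)
      have "(\<omega> has_derivative \<omega>' (t *\<^sub>R y)) (at (t *\<^sub>R y))"
        using \<omega> star[OF y t'] by (auto simp: closed_form_def)
      from has_derivative_compose[OF 1 this]
      have "((\<lambda>y. \<omega> (t *\<^sub>R y)) has_derivative (\<lambda>h. \<omega>' (t *\<^sub>R y) (t *\<^sub>R h))) (at y within S)" .
      from bounded_bilinear.FDERIV[OF bounded_bilinear_blinfun_apply this has_derivative_ident]
      have "((\<lambda>y. \<omega> (t *\<^sub>R y) y) has_derivative
          (\<lambda>h. \<omega> (t *\<^sub>R y) h + \<omega>' (t *\<^sub>R y) (t *\<^sub>R h) y)) (at y within S)" .
      \<comment> \<open>Closedness enters here: it exchanges h and y, so that h becomes the last
        argument as in \<open>fx\<close>.\<close>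
      moreover have "\<omega>' (t *\<^sub>R y) (t *\<^sub>R h) y = t *\<^sub>R \<omega>' (t *\<^sub>R y) y h" for h
      proof -
        have "\<omega>' (t *\<^sub>R y) h y = \<omega>' (t *\<^sub>R y) y h"
          using \<omega> star[OF y t'] unfolding closed_form_def by blast
        then show ?thesis by (simp add: \<omega>'_mult[OF y t'] blinfun.scaleR_left)
      qed
      ultimately show "((\<lambda>y. \<omega> (t *\<^sub>R y) y) has_derivative blinfun_apply (fx y t)) (at y within S)"
        by (simp add: fx_def plus_blinfun.rep_eq scaleR_blinfun.rep_eq add.commute)
    next
      fix y assume "y \<in> S"
      then show "(\<lambda>t. \<omega> (t *\<^sub>R y) y) integrable_on cbox 0 1"
        by (intro integrable_continuous blinfun.continuous_on continuous_on_const)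
          (auto simp: c_line)
    next
      have c1: "continuous_on (S \<times> cbox 0 1) (\<lambda>p. snd p *\<^sub>R fst p)"
        by (intro continuous_intros)
      show "continuous_on (S \<times> cbox 0 1) (\<lambda>(x, t). fx x t)"
        unfolding fx_def case_prod_unfold
        by (intro continuous_on_add continuous_on_scaleR continuous_on_snd continuous_on_id
              closed_form_continuous_compose[OF \<omega> c1] continuous_on_fst
              continuous_on_compose2[OF c\<omega> c1])
          (auto intro!: star)
    qed
    then show ?thesis
      using int[OF x] at_within_open[OF x S(1)] by (simp add: integral_unique)
  qed
  then show ?thesis unfolding exact_form_def by blast
qed

lemma exact_form_simply_connected_complex:
  fixes \<omega> :: "complex \<Rightarrow> complex \<Rightarrow>\<^sub>L complex"
  assumes \<omega>: "closed_form S \<omega> \<omega>'" and S: "open S" "simply_connected S"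
  shows "exact_form S \<omega>"
proof -
  \<comment> \<open>The plane is not biholomorphic to the disc, but it is convex already.\<close>
  consider "S = {}" | "S = UNIV" | f g where "f holomorphic_on S" "g holomorphic_on ball 0 1"
      "\<forall>z\<in>S. f z \<in> ball 0 1 \<and> g (f z) = z" "\<forall>z\<in>ball 0 1. g z \<in> S \<and> f (g z) = z"
    using S simply_connected_eq_biholomorphic_to_disc[OF S(1)] by blast
  then show ?thesis
  proof cases
    case 1
    then show ?thesis by (simp add: exact_form_def)
  next
    case 2
    then show ?thesis using exact_form_convex[OF \<omega>] S(1) by simp
  next
    case (3 f g)
    let ?B = "ball (0::complex) 1"
    \<comment> \<open>The real derivative of the holomorphic g is multiplication by g'(z). Its
      derivative in direction u is multiplication by g''(z) u, and symmetry holds because complex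
      multiplication commutes.\<close>
    define \<phi>' where "\<phi>' z = blinfun_mult_right (deriv g z)" for z
    define \<phi>'' where "\<phi>'' z u = blinfun_mult_right (deriv (deriv g) z * u)" for z u
    have g': "(g has_derivative blinfun_apply (\<phi>' z)) (at z)" if "z \<in> ?B" for z
      using holomorphic_derivI[OF 3(2) open_ball that]
      by (simp add: has_field_derivative_def \<phi>'_def)
    have hol': "deriv g holomorphic_on ?B" and hol'': "deriv (deriv g) holomorphic_on ?B"
      using 3(2) by (simp_all add: holomorphic_deriv)
    have "closed_form ?B \<phi>' \<phi>''"
      unfolding closed_form_def
    proof (intro conjI ballI allI)
      fix z assume z: "z \<in> ?B"
      have "(deriv g has_derivative (\<lambda>u. deriv (deriv g) z * u)) (at z)"
        using holomorphic_derivI[OF hol' open_ball z] by (simp add: has_field_derivative_def)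
      then show "(\<phi>' has_derivative \<phi>'' z) (at z)"
        unfolding \<phi>'_def \<phi>''_def
        by (rule bounded_linear.has_derivative[OF bounded_linear_blinfun_mult_right])
      show "\<phi>'' z u v = \<phi>'' z v u" for u v
        by (simp add: \<phi>''_def)
    next
      have "continuous_on (?B \<times> UNIV) (\<lambda>p. deriv (deriv g) (fst p))"
        by (rule continuous_on_compose2[OF holomorphic_on_imp_continuous_on[OF hol''] continuous_on_fst])
          (auto intro: continuous_on_id)
      then show "continuous_on (?B \<times> UNIV) (\<lambda>(z, u). \<phi>'' z u)"
        unfolding \<phi>''_def case_prod_unfold
        by (intro bounded_linear.continuous_on[OF bounded_linear_blinfun_mult_right] continuous_intros)
    qed
    then have "closed_form ?B (\<lambda>x. \<omega> (g x) o\<^sub>L \<phi>' x)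
        (\<lambda>x u. (\<omega> (g x) o\<^sub>L \<phi>'' x u) + (\<omega>' (g x) (\<phi>' x u) o\<^sub>L \<phi>' x))"
      using 3(4) by (intro closed_form_pullback[OF \<omega>] g') auto
    from exact_form_convex[OF this]
    have "exact_form ?B (\<lambda>x. \<omega> (g x) o\<^sub>L \<phi>' x)" by simp
    then show ?thesis
    proof (rule exact_form_of_pullback[OF _ S(1) g'])
      fix z assume z: "z \<in> S"
      have "f differentiable (at z)"
        using holomorphic_derivI[OF 3(1) S(1) z] by (auto simp: has_field_derivative_def differentiable_def)
      then show "f z \<in> ?B \<and> g (f z) = z \<and> f differentiable (at z)"
        using 3(3) z by blast
    qed
  qed
qed

text \<open>Riemann maps live on the type \<open>complex\<close>, so the form is carried over by the
  real-linear isomorphism L with inverse K. Being linear, L has a constant derivative, which is a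
  closed form with derivative zero.\<close>

lemma exact_form_simply_connected:
  fixes \<omega> :: "real^2 \<Rightarrow> (real^2) \<Rightarrow>\<^sub>L complex"
  assumes \<omega>: "closed_form \<Omega> \<omega> \<omega>'" and \<Omega>: "open \<Omega>" "simply_connected \<Omega>"
  shows "exact_form \<Omega> \<omega>"
proof -
  define L :: "complex \<Rightarrow> real^2" where "L z = Re z *\<^sub>R axis 1 1 + Im z *\<^sub>R axis 2 1" for z
  define K :: "real^2 \<Rightarrow> complex" where "K x = Complex (x $ 1) (x $ 2)" for x
  have LK: "L (K x) = x" for x
    by (simp add: L_def K_def vec_eq_iff forall_2 axis_def)
  have KL: "K (L z) = z" for z
    by (simp add: L_def K_def complex_eq_iff axis_def)
  have L: "bounded_linear L"
    unfolding L_def by (intro bounded_linear_intros bounded_linear_Re bounded_linear_Im)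
  have K: "bounded_linear K"
    by (rule linear_conv_bounded_linear[THEN iffD1], rule linearI)
      (auto simp: K_def complex_eq_iff)
  define S where "S = K ` \<Omega>"
  have S: "S = L -` \<Omega>"
    unfolding S_def by (auto simp: LK intro: image_eqI[where f = K, OF KL[symmetric]])
  have "\<Omega> homeomorphic S"
    unfolding homeomorphic_def homeomorphism_def S_def
    by (intro exI[of _ K] exI[of _ L]) (auto simp: LK KL image_image
        intro: linear_continuous_on L K)
  then have "simply_connected S"
    using \<Omega>(2) homeomorphic_simply_connected by blast
  have "open S"
    unfolding S using \<Omega>(1) linear_continuous_on[OF L, of UNIV] by (simp add: continuous_on_open_vimage)
  have L': "(L has_derivative blinfun_apply (Blinfun L)) (at z)" for z
    using L by (simp add: bounded_linear_Blinfun_apply bounded_linear_imp_has_derivative)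
  have "closed_form S (\<lambda>z. Blinfun L) (\<lambda>z u. 0)"
    by (auto simp: closed_form_def case_prod_unfold)
  from exact_form_simply_connected_complex[OF closed_form_pullback[OF \<omega> this L'] \<open>open S\<close> \<open>simply_connected S\<close>]
  have "exact_form S (\<lambda>z. \<omega> (L z) o\<^sub>L Blinfun L)"
    using S by simp
  then show ?thesis
    by (rule exact_form_of_pullback[OF _ \<Omega>(1) L', where \<psi> = K])
      (auto simp: LK S_def intro: bounded_linear_imp_differentiable K)
qed

lemma vec2_decomp: "u = (u $ 1) *\<^sub>R axis 1 1 + (u $ 2) *\<^sub>R axis 2 (1::real)" for u :: "real^2"
  by (simp add: vec_eq_iff forall_2 axis_def)

lemma derivative_eq_partial:
  assumes "f differentiable (at x)"
  shows "(f has_derivative (\<lambda>u. (u $ 1) *\<^sub>R partial 1 f x + (u $ 2) *\<^sub>R partial 2 f x)) (at x)"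
proof -
  let ?D = "frechet_derivative f (at x)"
  have D: "(f has_derivative ?D) (at x)" using assms by (rule has_derivative_frechet)
  then interpret bounded_linear ?D by (rule has_derivative_bounded_linear)
  have "?D = (\<lambda>u. (u $ 1) *\<^sub>R partial 1 f x + (u $ 2) *\<^sub>R partial 2 f x)"
  proof
    fix u :: "real^2"
    have "?D u = ?D ((u $ 1) *\<^sub>R axis 1 1 + (u $ 2) *\<^sub>R axis 2 1)"
      using vec2_decomp[of u] by simp
    then show "?D u = (u $ 1) *\<^sub>R partial 1 f x + (u $ 2) *\<^sub>R partial 2 f x"
      by (simp add: add scaleR partial_def)
  qed
  then show ?thesis using D by simp
qed

lemma smooth_potential:
  fixes h :: "2 \<Rightarrow> real^2 \<Rightarrow> complex"
  assumes \<Omega>: "open \<Omega>" "simply_connected \<Omega>"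
    and h: "\<And>j. smooth_fun \<Omega> (h j)"
    and closed: "\<And>x. x \<in> \<Omega> \<Longrightarrow> partial 1 (h 2) x = partial 2 (h 1) x"
  obtains f where "smooth_fun \<Omega> f" "\<And>j x. x \<in> \<Omega> \<Longrightarrow> partial j f x = h j x"
proof -
  \<comment> \<open>\<open>P j c\<close> is the constant form c dx_j, so that
    \<open>\<omega>\<close> below is h_1 dx_1 + h_2 dx_2.\<close>
  define P :: "2 \<Rightarrow> complex \<Rightarrow> (real^2) \<Rightarrow>\<^sub>L complex" where "P j c = Blinfun (\<lambda>u. (u $ j) *\<^sub>R c)" for j c
  have P_apply: "P j c u = (u $ j) *\<^sub>R c" for j c u
    unfolding P_def
    by (subst bounded_linear_Blinfun_apply)
      (auto intro!: bounded_linear_scaleR_const bounded_linear_vec_nth)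
  have P: "bounded_linear (P j)" for j
  proof (rule linear_conv_bounded_linear[THEN iffD1], rule linearI)
    show "P j (a + b) = P j a + P j b" for a b
      by (rule blinfun_eqI) (simp add: P_apply blinfun.add_left scaleR_add_right)
    show "P j (r *\<^sub>R a) = r *\<^sub>R P j a" for a r
      by (rule blinfun_eqI) (simp add: P_apply blinfun.scaleR_left scaleR_left_commute)
  qed
  define \<omega> where "\<omega> x = P 1 (h 1 x) + P 2 (h 2 x)" for x
  define dh where "dh j x u = (u $ 1) *\<^sub>R partial 1 (h j) x + (u $ 2) *\<^sub>R partial 2 (h j) x" for j x and u :: "real^2"
  define \<omega>' where "\<omega>' x u = P 1 (dh 1 x u) + P 2 (dh 2 x u)" for x u
  have cp: "continuous_on (\<Omega> \<times> UNIV) (\<lambda>p :: (real^2) \<times> (real^2). partial i (h j) (fst p))" for i j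
  proof (rule continuous_on_compose2[OF _ continuous_on_fst])
    show "continuous_on \<Omega> (partial i (h j))"
      using smooth_fun_partial[OF h] unfolding smooth_fun_def using C_k_on.simps(1) by blast
  qed (auto intro: continuous_on_id)
  have "closed_form \<Omega> \<omega> \<omega>'"
    unfolding closed_form_def
  proof (intro conjI ballI allI)
    fix x assume x: "x \<in> \<Omega>"
    have "(h j has_derivative dh j x) (at x)" for j
      unfolding dh_def by (intro derivative_eq_partial smooth_fun_differentiable[OF \<Omega>(1) h x])
    then show "(\<omega> has_derivative \<omega>' x) (at x)"
      unfolding \<omega>_def \<omega>'_def
      by (intro has_derivative_add bounded_linear.has_derivative[OF P])
    show "\<omega>' x u v = \<omega>' x v u" for u v
      by (simp add: \<omega>'_def dh_def P_apply blinfun.add_left closed[OF x] algebra_simps)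
  next
    show "continuous_on (\<Omega> \<times> UNIV) (\<lambda>(x, u). \<omega>' x u)"
      unfolding \<omega>'_def dh_def case_prod_unfold
      by (intro continuous_on_add bounded_linear.continuous_on[OF P] continuous_on_scaleR cp
            continuous_intros)
  qed
  then obtain f where f: "\<And>x. x \<in> \<Omega> \<Longrightarrow> (f has_derivative blinfun_apply (\<omega> x)) (at x)"
    using exact_form_simply_connected[OF _ \<Omega>] unfolding exact_form_def by blast
  have f': "partial j f x = h j x" if "x \<in> \<Omega>" for j x
  proof -
    have "j = 1 \<or> j = 2" using exhaust_2 by blast
    then show ?thesis
      using partial_eq_derivative[OF f[OF that], of j]
      by (auto simp: \<omega>_def P_apply blinfun.add_left axis_def)
  qed
  \<comment> \<open>On \<open>\<Omega>\<close> the partial derivatives of f are the smooth functions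
    \<open>h j\<close>, so differentiability of f bootstraps to all orders.\<close>
  have "smooth_fun \<Omega> f"
  proof (rule smooth_funI_partial)
    show "f differentiable_on \<Omega>"
      using f by (meson differentiableI differentiable_at_imp_differentiable_on)
    show "smooth_fun \<Omega> (partial j f)" for j
      using smooth_fun_cong[OF \<Omega>(1), of "partial j f" "h j"] f' h by blast
  qed
  then show ?thesis using f' by (rule that)
qed

section \<open>Graded calculus of superfields\<close>

lemma koszul_square: "koszul S T * koszul S T = 1"
  by (simp add: koszul_def flip: power_add mult_2)

text \<open>By disjointness every pair in S x T is an inversion for exactly one of the two orders,
  so the two inversion numbers add up to \<open>card S * card T\<close>.\<close>

lemma koszul_flip:
  fixes S T :: "'g::{finite,linorder} set"
  assumes "S \<inter> T = {}"
  shows "koszul T S = (- 1) ^ (card S * card T) * koszul S T"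
proof -
  let ?A = "{(s, t). s \<in> S \<and> t \<in> T \<and> t < s}" and ?B = "{(s, t). s \<in> S \<and> t \<in> T \<and> s < t}"
  have "S \<times> T = ?A \<union> ?B"
    using assms by (auto simp: not_less_iff_gr_or_eq)
  then have "card S * card T = card (?A \<union> ?B)"
    by (metis card_cartesian_product)
  also have "\<dots> = card ?A + card ?B"
    by (rule card_Un_disjoint) (auto intro: finite_inversions finite_subset[of _ "S \<times> T"])
  also have "card ?B = inversions T S"
    unfolding inversions_def
    by (rule bij_betw_same_card[of prod.swap]) (auto simp: bij_betw_def inj_on_def)
  finally have "card S * card T = inversions S T + inversions T S"
    by (simp add: inversions_def)
  then show ?thesis
    using koszul_square[of S T] by (simp add: koszul_def power_add)
qed

text \<open>The parity automorphism: +1 on even, -1 on odd elements. It expresses the sign (-1)^deg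
  of the graded Leibniz rule for elements of mixed parity as well.\<close>

definition grade_inv :: "'g grassmann \<Rightarrow> 'g grassmann" where
  "grade_inv a = Grassmann (\<lambda>S. (- 1) ^ card S * coeff a S)"

lemma coeff_grade_inv [simp]: "coeff (grade_inv a) S = (- 1) ^ card S * coeff a S"
  by (simp add: grade_inv_def)

lemma coeff_sum: "coeff (\<Sum>i\<in>I. f i) S = (\<Sum>i\<in>I. coeff (f i) S)"
  by (induction I rule: infinite_finite_induct) auto

lemma grade_inv_simps [simp]:
  "grade_inv 0 = 0" "grade_inv (- a) = - grade_inv a" "grade_inv (a + b) = grade_inv a + grade_inv b"
  "grade_inv (a - b) = grade_inv a - grade_inv b" "grade_inv (grade_inv a) = a"
  by (simp_all add: grassmann_eq_iff algebra_simps flip: power_add mult.assoc mult_2)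

lemma grade_inv_sum: "grade_inv (\<Sum>i\<in>I. f i) = (\<Sum>i\<in>I. grade_inv (f i))"
  by (simp add: grassmann_eq_iff coeff_sum sum_distrib_left)

lemma grade_inv_one [simp]: "grade_inv 1 = (1 :: 'g::{finite,linorder} grassmann)"
  by (simp add: grassmann_eq_iff one_grassmann.rep_eq)

text \<open>Cardinality is additive over the splitting of S into T and \<open>S - T\<close>, so the
  sign factors in every term of the product.\<close>

lemma grade_inv_mult: "grade_inv (a * b) = grade_inv a * grade_inv b"
  for a b :: "'g::{finite,linorder} grassmann"
  unfolding grassmann_eq_iff
proof
  fix S
  have "(- 1) ^ card S * (koszul T (S - T) * coeff a T * coeff b (S - T)) =
      koszul T (S - T) * ((- 1) ^ card T * coeff a T) * ((- 1) ^ card (S - T) * coeff b (S - T))"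
    if "T \<in> Pow S" for T
  proof -
    have "card S = card T + card (S - T)"
      using that by (metis PowD card_Diff_subset card_mono finite le_add_diff_inverse)
    then have "(- 1) ^ card S = (- 1) ^ card T * ((- 1 :: complex) ^ card (S - T))"
      by (simp only: power_add)
    then show ?thesis by (simp only: mult_ac)
  qed
  then show "coeff (grade_inv (a * b)) S = coeff (grade_inv a * grade_inv b) S"
    unfolding coeff_grade_inv coeff_times sum_distrib_left by (rule sum.cong[OF refl])
qed

lemma bosonic_iff_grade_inv: "bosonic a \<longleftrightarrow> grade_inv a = a"
proof -
  have "(- 1) ^ card S * c = c \<longleftrightarrow> (odd (card S) \<longrightarrow> c = 0)" for S :: "'a set" and c :: complex
    by (cases "even (card S)") auto
  then show ?thesis by (simp add: bosonic_def grassmann_eq_iff)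
qed

lemma fermionic_iff_grade_inv: "fermionic a \<longleftrightarrow> grade_inv a = - a"
proof -
  have "(- 1) ^ card S * c = - c \<longleftrightarrow> (even (card S) \<longrightarrow> c = 0)" for S :: "'a set" and c :: complex
    by (cases "even (card S)") auto
  then show ?thesis by (simp add: fermionic_def grassmann_eq_iff)
qed

text \<open>Only sets T of odd size contribute to a, and for these the flip sign (-1)^(|T| |S - T|)
  is (-1)^|S - T|, the sign that \<open>grade_inv\<close> puts on the coefficient of b.\<close>

lemma fermionic_times:
  fixes a b :: "'g::{finite,linorder} grassmann"
  assumes "fermionic a"
  shows "a * b = grade_inv b * a"
  unfolding grassmann_eq_iff
proof
  fix S
  have "coeff (grade_inv b * a) S =
      (\<Sum>T\<in>Pow S. koszul T (S - T) * ((- 1) ^ card T * coeff b T) * coeff a (S - T))"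
    by (simp add: coeff_times)
  also have "\<dots> = (\<Sum>T\<in>Pow S. koszul (S - T) T * ((- 1) ^ card (S - T) * coeff b (S - T)) * coeff a T)"
    by (rule sum.reindex_bij_witness[of _ "\<lambda>T. S - T" "\<lambda>T. S - T"]) (auto simp: double_diff)
  also have "\<dots> = (\<Sum>T\<in>Pow S. koszul T (S - T) * coeff a T * coeff b (S - T))"
  proof (rule sum.cong[OF refl])
    fix T assume "T \<in> Pow S"
    show "koszul (S - T) T * ((- 1) ^ card (S - T) * coeff b (S - T)) * coeff a T =
        koszul T (S - T) * coeff a T * coeff b (S - T)"
    proof (cases "even (card T)")
      case True
      then show ?thesis using assms by (simp add: fermionic_def)
    next
      case False
      have "T \<inter> (S - T) = {}" by blast
      from koszul_flip[OF this] have "koszul (S - T) T = (- 1) ^ card (S - T) * koszul T (S - T)"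
        using False by (simp add: power_mult)
      moreover have "(- 1) ^ card (S - T) * (- 1) ^ card (S - T) = (1 :: complex)"
        by (simp flip: power_add mult_2)
      ultimately show ?thesis by (simp add: mult_ac)
    qed
  qed
  also have "\<dots> = coeff (a * b) S" by (simp add: coeff_times)
  finally show "coeff (a * b) S = coeff (grade_inv b * a) S" by simp
qed

lemma fermionic_square:
  fixes a :: "'g::{finite,linorder} grassmann"
  assumes "fermionic a"
  shows "a * a = 0"
proof -
  have "a * a = - (a * a)"
    using fermionic_times[OF assms, of a] assms by (simp add: fermionic_iff_grade_inv)
  then have "coeff (a * a) S = - coeff (a * a) S" for S
    by (metis uminus_grassmann.rep_eq)
  then show ?thesis by (simp add: grassmann_eq_iff)
qed

lemma fermionic_gen: "fermionic (gen g)"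
  by (auto simp: fermionic_def gen_def)

lemma times_gen: "a * gen g = gen g * grade_inv a"
  for a :: "'g::{finite,linorder} grassmann"
  using fermionic_times[OF fermionic_gen, of g "grade_inv a"] by simp

section \<open>The odd derivative and its graded Leibniz rule\<close>

lemma coeff_dgen: "coeff (dgen g a) S = (if g \<in> S then 0 else koszul {g} S * coeff a (insert g S))"
  by (simp add: dgen_def)

lemma dgen_add: "dgen g (a + b) = dgen g a + dgen g b"
  by (simp add: grassmann_eq_iff coeff_dgen algebra_simps)

lemma dgen_one: "dgen g (1 :: 'g::{finite,linorder} grassmann) = 0"
  by (simp add: grassmann_eq_iff coeff_dgen one_grassmann.rep_eq)

lemma dgen_zero [simp]: "dgen g (0 :: 'g::{finite,linorder} grassmann) = 0"
  by (simp add: grassmann_eq_iff coeff_dgen)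

lemma dgen_minus: "dgen g (- a) = - dgen g a"
  by (simp add: grassmann_eq_iff coeff_dgen)

lemma dgen_eq_zero: "(\<And>S. g \<in> S \<Longrightarrow> coeff a S = 0) \<Longrightarrow> dgen g a = 0"
  by (simp add: grassmann_eq_iff coeff_dgen)

lemma dgen_gen_times:
  fixes a :: "'g::{finite,linorder} grassmann"
  assumes "\<And>S. g \<in> S \<Longrightarrow> coeff a S = 0"
  shows "dgen g (gen g * a) = a"
  using assms koszul_square[of "{g}"]
  by (auto simp: grassmann_eq_iff coeff_dgen coeff_gen_times Diff_insert_absorb simp flip: mult.assoc)

text \<open>The generator g lies in T or in \<open>S - T\<close>, and the factor belonging to that
  part vanishes: the elements free of g are closed under products.\<close>

lemma coeff_times_free:
  fixes a b :: "'g::{finite,linorder} grassmann"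
  assumes "\<And>S. g \<in> S \<Longrightarrow> coeff a S = 0" "\<And>S. g \<in> S \<Longrightarrow> coeff b S = 0" "g \<in> S"
  shows "coeff (a * b) S = 0"
proof -
  have "koszul T (S - T) * coeff a T * coeff b (S - T) = 0" for T
    using assms by (cases "g \<in> T") auto
  then show ?thesis unfolding coeff_times by (rule sum.neutral[OF ballI])
qed

text \<open>
  The proof writes \<open>a = a\<^sub>0 + g a\<^sub>1\<close> and \<open>b = b\<^sub>0 + g b\<^sub>1\<close> with all parts free of \<open>g\<close>, which avoids
  splitting the Koszul signs of the coefficients.
\<close>

lemma dgen_times:
  fixes a b :: "'g::{finite,linorder} grassmann"
  shows "dgen g (a * b) = dgen g a * b + grade_inv a * dgen g b"
proof -
  define a1 b1 where "a1 = dgen g a" and "b1 = dgen g b"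
  define a0 b0 where "a0 = a - gen g * a1" and "b0 = b - gen g * b1"
  have free1: "coeff a1 S = 0" "coeff b1 S = 0" if "g \<in> S" for S
    using that by (simp_all add: a1_def b1_def coeff_dgen)
  have free0: "coeff (c - gen g * dgen g c) S = 0" if "g \<in> S" for S and c :: "'g grassmann"
    using that koszul_square[of "{g}" "S - {g}"]
    by (simp add: coeff_gen_times coeff_dgen insert_absorb flip: mult.assoc)
  have free: "coeff a0 S = 0" "coeff b0 S = 0" if "g \<in> S" for S
    unfolding a0_def b0_def a1_def b1_def using free0[OF that] by simp_all
  have a: "a = a0 + gen g * a1" and b: "b = b0 + gen g * b1"
    by (simp_all add: a0_def b0_def)
  have gg: "gen g * gen g = 0"
    by (rule fermionic_square[OF fermionic_gen])
  have "a * b = a0 * b0 + (a0 * gen g) * b1 + gen g * (a1 * b0) + gen g * (a1 * gen g) * b1"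
    unfolding a b by (simp add: algebra_simps)
  also have "\<dots> = a0 * b0 + gen g * (grade_inv a0 * b1 + a1 * b0) + gen g * gen g * grade_inv a1 * b1"
    by (simp only: times_gen[of a0] times_gen[of a1]) (simp add: algebra_simps)
  finally have ab: "a * b = a0 * b0 + gen g * (grade_inv a0 * b1 + a1 * b0)"
    by (simp add: gg)
  have "dgen g (a * b) = grade_inv a0 * b1 + a1 * b0"
    unfolding ab dgen_add
    by (subst dgen_eq_zero, rule coeff_times_free[of g], (simp_all add: free)[3],
        subst dgen_gen_times) (simp_all add: coeff_times_free[of g] free free1)
  also have "\<dots> = a1 * b + grade_inv a * b1"
  proof -
    have "grade_inv (gen g) = - gen g"
      by (rule fermionic_iff_grade_inv[THEN iffD1, OF fermionic_gen])
    then have "grade_inv a = grade_inv a0 - gen g * grade_inv a1"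
      unfolding a by (simp add: grade_inv_mult)
    moreover have "a1 * b = a1 * b0 + gen g * grade_inv a1 * b1"
      using times_gen[of a1 g] unfolding b by (simp add: distrib_left flip: mult.assoc)
    ultimately show ?thesis by (simp add: left_diff_distrib mult.assoc)
  qed
  finally show ?thesis by (simp add: a1_def b1_def)
qed

lemma coeff_of_complex_times:
  "coeff (of_complex c * a) S = c * coeff a S" for a :: "'g::{finite,linorder} grassmann"
proof -
  have "coeff (of_complex c * a) S = (\<Sum>T\<in>Pow S. if T = {} then c * coeff a S else 0)"
    unfolding coeff_times of_complex_def by (rule sum.cong) auto
  then show ?thesis by simp
qed

lemma of_complex_times_commute:
  "a * of_complex c = of_complex c * a" for a :: "'g::{finite,linorder} grassmann"
proof -
  have "coeff (a * of_complex c) S = (\<Sum>T\<in>Pow S. if T = S then c * coeff a S else 0)" for S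
    unfolding coeff_times of_complex_def by (rule sum.cong) auto
  then show ?thesis by (simp add: grassmann_eq_iff coeff_of_complex_times)
qed

section \<open>Covariant derivatives of superfields\<close>

definition differentiable_field :: "'g superfield \<Rightarrow> real^2 \<Rightarrow> bool" where
  "differentiable_field f x \<longleftrightarrow> (\<forall>S. (\<lambda>y. coeff (f y) S) differentiable (at x))"

lemma smooth_differentiable_field:
  "open \<Omega> \<Longrightarrow> smooth \<Omega> f \<Longrightarrow> x \<in> \<Omega> \<Longrightarrow> differentiable_field f x"
  unfolding differentiable_field_def smooth_iff using smooth_fun_differentiable by blast

lemma differentiable_field_times:
  fixes f g :: "'g::{finite,linorder} superfield"
  assumes "differentiable_field f x" "differentiable_field g x"
  shows "differentiable_field (\<lambda>y. f y * g y) x"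
  using assms unfolding differentiable_field_def coeff_times
  by (auto intro!: differentiable_sum differentiable_mult)

lemma coeff_ddx: "coeff (ddx j f x) S = partial j (\<lambda>y. coeff (f y) S) x"
  by (simp add: ddx_def)

lemma ddx_times:
  fixes f g :: "'g::{finite,linorder} superfield"
  assumes "differentiable_field f x" "differentiable_field g x"
  shows "ddx j (\<lambda>y. f y * g y) x = ddx j f x * g x + f x * ddx j g x"
  unfolding grassmann_eq_iff
proof
  fix S
  have f: "(\<lambda>y. coeff (f y) T) differentiable (at x)" and g: "(\<lambda>y. coeff (g y) T) differentiable (at x)" for T
    using assms by (auto simp: differentiable_field_def)
  have "coeff (ddx j (\<lambda>y. f y * g y) x) S =
      (\<Sum>T\<in>Pow S. partial j (\<lambda>y. (koszul T (S - T) * coeff (f y) T) * coeff (g y) (S - T)) x)"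
    unfolding coeff_ddx coeff_times
    by (rule partial_sum) (auto intro!: differentiable_mult f g)
  also have "\<dots> = (\<Sum>T\<in>Pow S. koszul T (S - T) * coeff (ddx j f x) T * coeff (g x) (S - T) +
      koszul T (S - T) * coeff (f x) T * coeff (ddx j g x) (S - T))"
    by (rule sum.cong[OF refl])
      (simp add: partial_mult partial_cmult differentiable_mult f g coeff_ddx)
  also have "\<dots> = coeff (ddx j f x * g x + f x * ddx j g x) S"
    by (simp add: coeff_times sum.distrib)
  finally show "coeff (ddx j (\<lambda>y. f y * g y) x) S = \<dots>" .
qed

text \<open>The x-part of the covariant derivative obeys the same twisted rule as the theta-part:
  moving \<open>gen (Theta j)\<close> to the left past \<open>grade_inv (f x)\<close> undoes the
  involution.\<close>

lemma cov_times:
  fixes f g :: "'g::{finite,linorder} superfield"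
  assumes "differentiable_field f x" "differentiable_field g x"
  shows "cov j (\<lambda>y. f y * g y) x = cov j f x * g x + grade_inv (f x) * cov j g x"
proof -
  let ?\<theta> = "gen (Theta j) :: 'g generator grassmann" and ?i = "of_complex \<i> :: 'g generator grassmann"
  have "grade_inv (f x) * (?i * ?\<theta> * ddx j g x) = (grade_inv (f x) * ?i) * ?\<theta> * ddx j g x"
    by (simp only: mult.assoc)
  also have "\<dots> = ?i * (grade_inv (f x) * ?\<theta>) * ddx j g x"
    by (simp only: of_complex_times_commute mult.assoc)
  also have "\<dots> = ?i * ?\<theta> * f x * ddx j g x"
    by (simp only: times_gen[of "grade_inv (f x)"] grade_inv_simps mult.assoc)
  finally show ?thesis
    unfolding cov_def ddx_times[OF assms] dgen_times by (simp add: algebra_simps)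
qed

text \<open>The x-part contributes only to sets containing \<open>Theta j\<close>, the theta-part
  only to the others. Hence D_j F = B_j decouples into equations that each involve a single
  coefficient of F.\<close>

lemma coeff_cov:
  "coeff (cov j f x) S = (if Theta j \<in> S
    then - \<i> * koszul {Theta j} (S - {Theta j}) * partial j (\<lambda>y. coeff (f y) (S - {Theta j})) x
    else koszul {Theta j} S * coeff (f x) (insert (Theta j) S))"
  unfolding cov_def
  by (simp add: mult.assoc coeff_dgen coeff_of_complex_times coeff_gen_times coeff_ddx)

lemma cov_sum:
  fixes f :: "'i \<Rightarrow> 'g::{finite,linorder} superfield"
  assumes "finite I" "\<And>i. i \<in> I \<Longrightarrow> differentiable_field (f i) x"
  shows "cov j (\<lambda>y. \<Sum>i\<in>I. f i y) x = (\<Sum>i\<in>I. cov j (f i) x)"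
  using assms
  by (auto simp: grassmann_eq_iff coeff_cov coeff_sum partial_sum differentiable_field_def sum_distrib_left)

lemma cov_cong:
  assumes "open \<Omega>" "x \<in> \<Omega>" "\<And>y. y \<in> \<Omega> \<Longrightarrow> f y = g y"
  shows "cov j f x = cov j g x"
proof -
  have "partial j (\<lambda>y. coeff (f y) S) x = partial j (\<lambda>y. coeff (g y) S) x" for S
    using assms by (intro partial_cong[OF assms(1,2)]) simp
  then show ?thesis
    using assms(2,3) by (simp add: grassmann_eq_iff coeff_cov)
qed

lemma cov_const: "cov j (\<lambda>y. c) x = dgen (Theta j) c"
  by (simp add: grassmann_eq_iff coeff_cov coeff_dgen)

lemma smooth_times:
  fixes f g :: "'g::{finite,linorder} superfield"
  assumes "open \<Omega>" "smooth \<Omega> f" "smooth \<Omega> g"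
  shows "smooth \<Omega> (\<lambda>x. f x * g x)"
  using assms unfolding smooth_iff coeff_times
  by (auto intro!: smooth_fun_sum smooth_fun_mult smooth_fun_const)

lemma smooth_sum:
  assumes "open \<Omega>" "\<And>i. i \<in> I \<Longrightarrow> smooth \<Omega> (f i)"
  shows "smooth \<Omega> (\<lambda>x. \<Sum>i\<in>I. f i x)"
  using assms unfolding smooth_iff coeff_sum by (auto intro!: smooth_fun_sum)

lemma smooth_const: "smooth \<Omega> (\<lambda>x. c)"
  by (simp add: smooth_iff smooth_fun_const)

text \<open>The truth value \<open>p\<close> says that F is to be even and the \<open>B j\<close>
  odd, its negation the reverse; one statement thus serves all blocks of a supermatrix. A
  coefficient of F containing an odd coordinate is read off algebraically, and compatibility is
  needed because there are two equations for F.\<close>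

lemma cov_potential:
  fixes B :: "2 \<Rightarrow> 'g::{finite,linorder} superfield"
  assumes \<Omega>: "open \<Omega>" "simply_connected \<Omega>"
    and B: "\<And>j. smooth \<Omega> (B j)"
    and compat: "\<And>x. x \<in> \<Omega> \<Longrightarrow> cov 1 (B 2) x + cov 2 (B 1) x = 0"
    and parity: "\<And>j x S. x \<in> \<Omega> \<Longrightarrow> even (card S) = p \<Longrightarrow> coeff (B j x) S = 0"
  obtains F where "smooth \<Omega> F" "\<And>j x. x \<in> \<Omega> \<Longrightarrow> cov j F x = B j x"
    "\<And>x S. x \<in> \<Omega> \<Longrightarrow> even (card S) \<noteq> p \<Longrightarrow> coeff (F x) S = 0"
proof -
  let ?\<theta> = "Theta :: 2 \<Rightarrow> 'g generator"
  define \<kappa> where "\<kappa> j S = koszul {?\<theta> j} S" for j S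
  have \<kappa>2: "\<kappa> j S * \<kappa> j S = 1" for j S
    unfolding \<kappa>_def by (rule koszul_square)
  \<comment> \<open>The minus sign is the anticommutation of the two odd coordinates.\<close>
  have \<kappa>_flip: "\<kappa> 2 {?\<theta> 1} = - \<kappa> 1 {?\<theta> 2}"
    using koszul_flip[of "{?\<theta> 1}" "{?\<theta> 2}"] by (simp add: \<kappa>_def)
  have \<kappa>_insert: "\<kappa> j (insert (?\<theta> k) S) = \<kappa> j {?\<theta> k} * \<kappa> j S" if "?\<theta> k \<notin> S" for j k S
    unfolding \<kappa>_def using koszul_Un_right[of "{?\<theta> k}" S "{?\<theta> j}"] that by simp
  have cancel: "\<kappa> j S * a = b \<longleftrightarrow> a = \<kappa> j S * b" for j S a b
    using \<kappa>2[of j S] by (metis mult.assoc mult_1)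
  have \<kappa>_nz: "\<kappa> j S \<noteq> 0" for j S
    using \<kappa>2[of j S] by auto
  have j12: "j = 1 \<or> j = 2" for j :: 2 by (rule exhaust_2)
  have smoothB: "smooth_fun \<Omega> (\<lambda>x. coeff (B j x) S)" for j S
    using B by (simp add: smooth_iff)
  have \<theta>\<theta>: "insert (?\<theta> 1) S - {?\<theta> 2} = insert (?\<theta> 1) (S - {?\<theta> 2})"
    "insert (?\<theta> 2) S - {?\<theta> 1} = insert (?\<theta> 2) (S - {?\<theta> 1})" for S by auto

  \<comment> \<open>The four facts below are the coefficients of D_1 B_2 + D_2 B_1 = 0 according to
    which odd coordinates occur besides P. \<open>comp0\<close> reconciles the two formulas for the
    coefficient of F with both, \<open>comp1\<close> and \<open>comp2\<close> give the derivatives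
    of those with one, and \<open>comp12\<close> is the closedness of the 1-form for the one with
    none.\<close>
  have comp0: "\<kappa> 1 P * coeff (B 2 x) (insert (?\<theta> 1) P) = - (\<kappa> 2 P * coeff (B 1 x) (insert (?\<theta> 2) P))"
    if "x \<in> \<Omega>" "?\<theta> 1 \<notin> P" "?\<theta> 2 \<notin> P" for x P
    using compat[OF that(1)] that(2,3) unfolding grassmann_eq_iff
    by (auto dest!: spec[of _ P] simp: coeff_cov \<kappa>_def eq_neg_iff_add_eq_0)
  have comp1: "\<kappa> 2 (insert (?\<theta> 1) P) * coeff (B 1 x) (insert (?\<theta> 2) (insert (?\<theta> 1) P)) =
      \<i> * \<kappa> 1 P * partial 1 (\<lambda>y. coeff (B 2 y) P) x"
    if "x \<in> \<Omega>" "?\<theta> 1 \<notin> P" "?\<theta> 2 \<notin> P" for x P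
    using compat[OF that(1)] that(2,3) unfolding grassmann_eq_iff
    by (auto dest!: spec[of _ "insert (?\<theta> 1) P"] simp: coeff_cov \<kappa>_def)
  have comp2: "\<kappa> 1 (insert (?\<theta> 2) P) * coeff (B 2 x) (insert (?\<theta> 1) (insert (?\<theta> 2) P)) =
      \<i> * \<kappa> 2 P * partial 2 (\<lambda>y. coeff (B 1 y) P) x"
    if "x \<in> \<Omega>" "?\<theta> 1 \<notin> P" "?\<theta> 2 \<notin> P" for x P
    using compat[OF that(1)] that(2,3) unfolding grassmann_eq_iff
    by (auto dest!: spec[of _ "insert (?\<theta> 2) P"] simp: coeff_cov \<kappa>_def)
  have comp12: "\<kappa> 1 (insert (?\<theta> 2) P) * partial 1 (\<lambda>y. coeff (B 2 y) (insert (?\<theta> 2) P)) x =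
      - (\<kappa> 2 (insert (?\<theta> 1) P) * partial 2 (\<lambda>y. coeff (B 1 y) (insert (?\<theta> 1) P)) x)"
    if "x \<in> \<Omega>" "?\<theta> 1 \<notin> P" "?\<theta> 2 \<notin> P" for x P
  proof -
    have 1: "insert (?\<theta> 1) (insert (?\<theta> 2) P) - {?\<theta> 1} = insert (?\<theta> 2) P"
      "insert (?\<theta> 1) (insert (?\<theta> 2) P) - {?\<theta> 2} = insert (?\<theta> 1) P"
      using that(2,3) by auto
    have "coeff (cov 1 (B 2) x + cov 2 (B 1) x) (insert (?\<theta> 1) (insert (?\<theta> 2) P)) = 0"
      by (simp add: compat[OF that(1)])
    then have "- \<i> * \<kappa> 1 (insert (?\<theta> 2) P) * partial 1 (\<lambda>y. coeff (B 2 y) (insert (?\<theta> 2) P)) x +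
      - \<i> * \<kappa> 2 (insert (?\<theta> 1) P) * partial 2 (\<lambda>y. coeff (B 1 y) (insert (?\<theta> 1) P)) x = 0"
      unfolding plus_grassmann.rep_eq coeff_cov 1 by (simp add: \<kappa>_def)
    then have "- \<i> * (\<kappa> 1 (insert (?\<theta> 2) P) * partial 1 (\<lambda>y. coeff (B 2 y) (insert (?\<theta> 2) P)) x +
      \<kappa> 2 (insert (?\<theta> 1) P) * partial 2 (\<lambda>y. coeff (B 1 y) (insert (?\<theta> 1) P)) x) = 0"
      by (simp only: distrib_left mult.assoc)
    then show ?thesis by (simp add: eq_neg_iff_add_eq_0)
  qed

  \<comment> \<open>The last conjunct fixes the constant of integration: for a set P of the wrong
    parity the prescribed derivatives vanish, and zero is the constant that keeps F
    homogeneous.\<close>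
  let ?Q = "\<lambda>P f. smooth_fun \<Omega> f \<and>
      (\<forall>j. \<forall>x\<in>\<Omega>. partial j f x = \<i> * \<kappa> j P * coeff (B j x) (insert (?\<theta> j) P)) \<and>
      (even (card P) \<noteq> p \<longrightarrow> f = (\<lambda>x. 0))"
  have ex_f0: "\<exists>f. ?Q P f"
    if P: "?\<theta> 1 \<notin> P" "?\<theta> 2 \<notin> P" for P
  proof (cases "even (card P) = p")
    case False
    have "coeff (B j x) (insert (?\<theta> j) P) = 0" if "x \<in> \<Omega>" for j x
      using P j12[of j] False by (intro parity[OF that]) auto
    then show ?thesis by (intro exI[of _ "\<lambda>x. 0"]) (simp add: smooth_fun_const)
  next
    case True
    define h where "h j x = \<i> * \<kappa> j P * coeff (B j x) (insert (?\<theta> j) P)" for j x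
    have "smooth_fun \<Omega> (h j)" for j
      unfolding h_def by (intro smooth_fun_mult smooth_fun_const smoothB \<Omega>(1))
    moreover have "partial 1 (h 2) x = partial 2 (h 1) x" if x: "x \<in> \<Omega>" for x
    proof -
      have h': "partial k (h j) x = \<i> * \<kappa> j P * partial k (\<lambda>y. coeff (B j y) (insert (?\<theta> j) P)) x" for j k
        unfolding h_def by (intro partial_cmult smooth_fun_differentiable[OF \<Omega>(1) smoothB x])
      define X Y where "X = partial 1 (\<lambda>y. coeff (B 2 y) (insert (?\<theta> 2) P)) x"
        and "Y = partial 2 (\<lambda>y. coeff (B 1 y) (insert (?\<theta> 1) P)) x"
      \<comment> \<open>The minus sign of \<open>comp12\<close> cancels against that of
        \<open>\<kappa>_flip\<close>; the remaining signs square to one and can be moved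
        across.\<close>
      have "\<kappa> 1 {?\<theta> 2} * (\<kappa> 1 P * X) = \<kappa> 1 {?\<theta> 2} * (\<kappa> 2 P * Y)"
        using comp12[OF x P] by (simp add: \<kappa>_insert[OF P(1)] \<kappa>_insert[OF P(2)] \<kappa>_flip X_def Y_def)
      then have "\<kappa> 1 P * X = \<kappa> 2 P * Y"
        by (simp add: \<kappa>_nz)
      then have X: "X = \<kappa> 1 P * (\<kappa> 2 P * Y)"
        by (rule cancel[THEN iffD1])
      have "\<kappa> 2 P * X = (\<kappa> 2 P * \<kappa> 2 P) * (\<kappa> 1 P * Y)"
        unfolding X by (simp only: mult_ac)
      then have "\<kappa> 2 P * X = \<kappa> 1 P * Y"
        by (simp only: \<kappa>2 mult_1)
      then show ?thesis by (simp add: h' X_def Y_def mult.assoc)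
    qed
    ultimately obtain f where "smooth_fun \<Omega> f" "\<And>j x. x \<in> \<Omega> \<Longrightarrow> partial j f x = h j x"
      using smooth_potential[OF \<Omega>] by metis
    then show ?thesis using True by (auto simp: h_def)
  qed
  define f0 where "f0 P = (SOME f. ?Q P f)" for P
  have Q: "?Q P (f0 P)" if "?\<theta> 1 \<notin> P" "?\<theta> 2 \<notin> P" for P
    unfolding f0_def by (rule someI_ex[OF ex_f0[OF that]])
  have f0: "smooth_fun \<Omega> (f0 P)"
      "x \<in> \<Omega> \<Longrightarrow> partial j (f0 P) x = \<i> * \<kappa> j P * coeff (B j x) (insert (?\<theta> j) P)"
      "even (card P) \<noteq> p \<Longrightarrow> f0 P = (\<lambda>x. 0)"
    if "?\<theta> 1 \<notin> P" "?\<theta> 2 \<notin> P" for P j x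
    using Q[OF that] by simp_all

  \<comment> \<open>If S contains both odd coordinates, both equations prescribe this coefficient.
    The definition follows the first; agreement with the second is the last case of
    \<open>insertFc\<close>.\<close>
  define Fc where "Fc S x =
    (if ?\<theta> 1 \<in> S then \<kappa> 1 (S - {?\<theta> 1}) * coeff (B 1 x) (S - {?\<theta> 1})
     else if ?\<theta> 2 \<in> S then \<kappa> 2 (S - {?\<theta> 2}) * coeff (B 2 x) (S - {?\<theta> 2})
     else f0 S x)" for S x
  have smoothFc: "smooth_fun \<Omega> (Fc S)" for S
    unfolding Fc_def using f0(1)[of S]
    by (cases "?\<theta> 1 \<in> S"; cases "?\<theta> 2 \<in> S")
      (simp_all add: smooth_fun_mult smooth_fun_const smoothB \<Omega>(1))

  \<comment> \<open>This is the theta-part of D_j F = B_j, at the sets not containing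
    \<open>?\<theta> j\<close>.\<close>
  have insertFc: "Fc (insert (?\<theta> j) S) x = \<kappa> j S * coeff (B j x) S"
    if x: "x \<in> \<Omega>" and S: "?\<theta> j \<notin> S" for j S x
  proof -
    consider "j = 1" | "j = 2" "?\<theta> 1 \<notin> S" | "j = 2" "?\<theta> 1 \<in> S" using j12 by blast
    then show ?thesis
    proof cases
      case 1
      then show ?thesis using S by (simp add: Fc_def)
    next
      case 2
      then show ?thesis using S by (simp add: Fc_def)
    next
      case 3
      define P where "P = S - {?\<theta> 1}"
      have P: "S = insert (?\<theta> 1) P" "?\<theta> 1 \<notin> P" "?\<theta> 2 \<notin> P"
        using 3 S by (auto simp: P_def)
      have "Fc (insert (?\<theta> 2) S) x = \<kappa> 1 (insert (?\<theta> 2) P) * coeff (B 1 x) (insert (?\<theta> 2) P)"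
        using P(2) by (simp add: Fc_def P(1) insert_commute)
      also have "\<dots> = \<kappa> 1 {?\<theta> 2} * (\<kappa> 1 P * coeff (B 1 x) (insert (?\<theta> 2) P))"
        using P by (simp add: \<kappa>_insert[OF P(2)] \<kappa>_insert[OF P(3)])
      also have "\<kappa> 1 P * coeff (B 1 x) (insert (?\<theta> 2) P) = - (\<kappa> 2 P * coeff (B 2 x) S)"
      proof -
        have "coeff (B 2 x) S = \<kappa> 1 P * - (\<kappa> 2 P * coeff (B 1 x) (insert (?\<theta> 2) P))"
          unfolding P(1) by (rule cancel[THEN iffD1, OF comp0[OF x P(2,3)]])
        then have "\<kappa> 2 P * coeff (B 2 x) S = \<kappa> 2 P * \<kappa> 2 P * (- \<kappa> 1 P * coeff (B 1 x) (insert (?\<theta> 2) P))"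
          by (simp add: mult_ac)
        then show ?thesis by (simp add: \<kappa>2)
      qed
      finally show ?thesis
        using 3 P by (simp add: \<kappa>_insert[OF P(2)] \<kappa>_insert[OF P(3)] \<kappa>_flip)
    qed
  qed

  \<comment> \<open>This is the x-part of D_j F = B_j, at the sets
    \<open>insert (?\<theta> j) S\<close>. If S is free of both odd coordinates it holds by the
    choice of \<open>f0\<close>; otherwise the coefficient is already determined and
    \<open>comp1\<close> or \<open>comp2\<close> supplies its derivative.\<close>
  have partialFc: "partial j (Fc S) x = \<i> * \<kappa> j S * coeff (B j x) (insert (?\<theta> j) S)"
    if x: "x \<in> \<Omega>" and S: "?\<theta> j \<notin> S" for j S x
  proof -
    consider "?\<theta> 1 \<notin> S" "?\<theta> 2 \<notin> S" | "j = 1" "?\<theta> 2 \<in> S" | "j = 2" "?\<theta> 1 \<in> S"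
      using j12[of j] S by blast
    then show ?thesis
    proof cases
      case 1
      then have "Fc S = f0 S" by (simp add: Fc_def fun_eq_iff)
      then show ?thesis using f0(2)[OF 1 x] by simp
    next
      case 2
      define P where "P = S - {?\<theta> 2}"
      have P: "S = insert (?\<theta> 2) P" "?\<theta> 1 \<notin> P" "?\<theta> 2 \<notin> P"
        using 2 S by (auto simp: P_def)
      have "Fc S = (\<lambda>x. \<kappa> 2 P * coeff (B 2 x) P)"
        using P by (simp add: Fc_def fun_eq_iff)
      then have "partial j (Fc S) x = \<kappa> 2 P * partial 1 (\<lambda>y. coeff (B 2 y) P) x"
        using 2 by (simp add: partial_cmult smooth_fun_differentiable[OF \<Omega>(1) smoothB x])
      moreover have "partial 1 (\<lambda>y. coeff (B 2 y) P) x =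
          \<kappa> 1 P * (- \<i> * (\<kappa> 2 {?\<theta> 1} * \<kappa> 2 P * coeff (B 1 x) (insert (?\<theta> 1) S)))"
      proof -
        have "\<kappa> 1 P * partial 1 (\<lambda>y. coeff (B 2 y) P) x =
            - \<i> * (\<i> * \<kappa> 1 P * partial 1 (\<lambda>y. coeff (B 2 y) P) x)"
          by (simp flip: mult.assoc)
        also have "\<dots> = - \<i> * (\<kappa> 2 {?\<theta> 1} * \<kappa> 2 P * coeff (B 1 x) (insert (?\<theta> 1) S))"
          using comp1[OF x P(2,3)] P by (simp add: \<kappa>_insert[OF P(2)] \<kappa>_insert[OF P(3)] insert_commute)
        finally show ?thesis by (rule cancel[THEN iffD1])
      qed
      ultimately have "partial j (Fc S) x = (\<kappa> 2 P * \<kappa> 2 P) *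
          (\<i> * (\<kappa> 1 {?\<theta> 2} * \<kappa> 1 P) * coeff (B 1 x) (insert (?\<theta> 1) S))"
        by (simp add: \<kappa>_flip mult_ac)
      then show ?thesis using 2 P by (simp add: \<kappa>2 \<kappa>_insert[OF P(2)] \<kappa>_insert[OF P(3)])
    next
      case 3
      define P where "P = S - {?\<theta> 1}"
      have P: "S = insert (?\<theta> 1) P" "?\<theta> 1 \<notin> P" "?\<theta> 2 \<notin> P"
        using 3 S by (auto simp: P_def)
      have "Fc S = (\<lambda>x. \<kappa> 1 P * coeff (B 1 x) P)"
        using P by (simp add: Fc_def fun_eq_iff)
      then have "partial j (Fc S) x = \<kappa> 1 P * partial 2 (\<lambda>y. coeff (B 1 y) P) x"
        using 3 by (simp add: partial_cmult smooth_fun_differentiable[OF \<Omega>(1) smoothB x])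
      moreover have "partial 2 (\<lambda>y. coeff (B 1 y) P) x =
          \<kappa> 2 P * (- \<i> * (\<kappa> 1 {?\<theta> 2} * \<kappa> 1 P * coeff (B 2 x) (insert (?\<theta> 2) S)))"
      proof -
        have "\<kappa> 2 P * partial 2 (\<lambda>y. coeff (B 1 y) P) x =
            - \<i> * (\<i> * \<kappa> 2 P * partial 2 (\<lambda>y. coeff (B 1 y) P) x)"
          by (simp flip: mult.assoc)
        also have "\<dots> = - \<i> * (\<kappa> 1 {?\<theta> 2} * \<kappa> 1 P * coeff (B 2 x) (insert (?\<theta> 2) S))"
          using comp2[OF x P(2,3)] P by (simp add: \<kappa>_insert[OF P(2)] \<kappa>_insert[OF P(3)] insert_commute)
        finally show ?thesis by (rule cancel[THEN iffD1])
      qed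
      ultimately have "partial j (Fc S) x = (\<kappa> 1 P * \<kappa> 1 P) *
          (\<i> * (\<kappa> 2 {?\<theta> 1} * \<kappa> 2 P) * coeff (B 2 x) (insert (?\<theta> 2) S))"
        by (simp add: \<kappa>_flip mult_ac)
      then show ?thesis using 3 P by (simp add: \<kappa>2 \<kappa>_insert[OF P(2)] \<kappa>_insert[OF P(3)])
    qed
  qed

  define F where "F x = Grassmann (\<lambda>S. Fc S x)" for x
  have coeffF: "coeff (F x) S = Fc S x" for x S by (simp add: F_def)
  show ?thesis
  proof
    show "smooth \<Omega> F" by (simp add: smooth_iff coeffF smoothFc)
    show "cov j F x = B j x" if x: "x \<in> \<Omega>" for j x
      unfolding grassmann_eq_iff
    proof
      fix S
      show "coeff (cov j F x) S = coeff (B j x) S"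
      proof (cases "?\<theta> j \<in> S")
        case True
        have "coeff (cov j F x) S = - \<i> * \<kappa> j (S - {?\<theta> j}) * partial j (Fc (S - {?\<theta> j})) x"
          using True by (simp add: coeff_cov coeffF \<kappa>_def)
        also have "\<dots> = (\<kappa> j (S - {?\<theta> j}) * \<kappa> j (S - {?\<theta> j})) * coeff (B j x) S"
          using True by (simp add: partialFc[OF x] insert_absorb mult_ac)
        finally show ?thesis by (simp add: \<kappa>2)
      next
        case False
        have "coeff (cov j F x) S = (\<kappa> j S * \<kappa> j S) * coeff (B j x) S"
          using False by (simp add: coeff_cov coeffF insertFc[OF x] mult.assoc flip: \<kappa>_def)
        then show ?thesis by (simp add: \<kappa>2)
      qed
    qed
    show "coeff (F x) S = 0" if x: "x \<in> \<Omega>" and S: "even (card S) \<noteq> p" for x S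
    proof -
      \<comment> \<open>\<open>Fc\<close> reads a coefficient containing an odd coordinate from
        \<open>B\<close> at a set smaller by one element, hence of opposite parity.\<close>
      have "coeff (B j x) (S - {?\<theta> j}) = 0" if "?\<theta> j \<in> S" for j
      proof (rule parity[OF x])
        have "Suc (card (S - {?\<theta> j})) = card S"
          by (rule card_Suc_Diff1[OF finite that])
        then have "even (card S) \<longleftrightarrow> odd (card (S - {?\<theta> j}))"
          by (metis even_Suc)
        then show "even (card (S - {?\<theta> j})) = p" using S by blast
      qed
      then show ?thesis using f0(3)[of S] S by (auto simp: coeffF Fc_def)
    qed
  qed
qed

section \<open>Calculus of supermatrices\<close>

lemma matrix_mult_add_left: "(A + B) ** C = A ** C + B ** C"
  for A B C :: "'a::ring_1^'n^'n"
  by (simp add: vec_eq_iff matrix_matrix_mult_def distrib_right sum.distrib)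

lemma matrix_mult_minus_left: "(- A) ** C = - (A ** C)"
  for A C :: "'a::ring_1^'n^'n"
  by (simp add: vec_eq_iff matrix_matrix_mult_def sum_negf)

lemma matrix_mult_minus_right: "A ** (- C) = - (A ** C)"
  for A C :: "'a::ring_1^'n^'n"
  by (simp add: vec_eq_iff matrix_matrix_mult_def sum_negf)

lemma matrix_mult_diff_left: "(A - B) ** C = A ** C - B ** C"
  for A B C :: "'a::ring_1^'n^'n"
  by (simp add: vec_eq_iff matrix_matrix_mult_def left_diff_distrib sum_subtractf)

lemma matrix_mult_diff_right: "C ** (A - B) = C ** A - C ** B"
  for A B C :: "'a::ring_1^'n^'n"
  by (simp add: vec_eq_iff matrix_matrix_mult_def right_diff_distrib sum_subtractf)

lemmas matrix_ring_simps = matrix_mult_add_left matrix_add_ldistrib matrix_mult_minus_left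
  matrix_mult_minus_right matrix_mult_diff_left matrix_mult_diff_right

lemma mat_mult_nth: "(mat c ** M) $ i $ j = c * M $ i $ j" for M :: "'a::ring_1^'n^'n"
proof -
  have "(mat c ** M) $ i $ j = (\<Sum>k\<in>UNIV. if k = i then c * M $ i $ j else 0)"
    unfolding matrix_matrix_mult_def mat_def vec_lambda_beta by (rule sum.cong) auto
  then show ?thesis by simp
qed

lemma mult_mat_nth: "(M ** mat c) $ i $ j = M $ i $ j * c" for M :: "'a::ring_1^'n^'n"
proof -
  have "(M ** mat c) $ i $ j = (\<Sum>k\<in>UNIV. if k = j then M $ i $ j * c else 0)"
    unfolding matrix_matrix_mult_def mat_def vec_lambda_beta by (rule sum.cong) auto
  then show ?thesis by simp
qed

lemma matrix_inv_mult:
  fixes A :: "'a::semiring_1^'n^'n"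
  assumes "invertible A"
  shows "A ** matrix_inv A = mat 1" "matrix_inv A ** A = mat 1"
  using someI_ex[OF assms[unfolded invertible_def]] by (auto simp: matrix_inv_def)

lemma E_mult_nth: "(E ** M) $ i $ j = (if isl i then M $ i $ j else - M $ i $ j)"
proof -
  have "(E ** M) $ i $ j = (\<Sum>k\<in>UNIV. if k = i then if isl i then M $ i $ j else - M $ i $ j else 0)"
    unfolding matrix_matrix_mult_def E_def vec_lambda_beta by (rule sum.cong) auto
  then show ?thesis by simp
qed

lemma mult_E_nth: "(M ** E) $ i $ j = (if isl j then M $ i $ j else - M $ i $ j)"
proof -
  have "(M ** E) $ i $ j = (\<Sum>k\<in>UNIV. if k = j then if isl j then M $ i $ j else - M $ i $ j else 0)"
    unfolding matrix_matrix_mult_def E_def vec_lambda_beta by (rule sum.cong) auto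
  then show ?thesis by simp
qed

lemma E_E: "E ** E = mat 1"
  unfolding vec_eq_iff by (intro allI) (simp add: E_mult_nth, simp add: E_def mat_def)

lemma E_E_mult: "E ** (E ** M) = M"
  by (simp add: matrix_mul_assoc E_E)

section \<open>Parity of supermatrices as a matrix identity\<close>

definition grade_inv_mat :: "('p::finite, 'q::finite, 'g) supermatrix \<Rightarrow> ('p, 'q, 'g) supermatrix" where
  "grade_inv_mat M = (\<chi> i j. grade_inv (M $ i $ j))"

lemma grade_inv_mat_nth [simp]: "grade_inv_mat M $ i $ j = grade_inv (M $ i $ j)"
  by (simp add: grade_inv_mat_def)

lemma grade_inv_mat_mult: "grade_inv_mat (M ** N) = grade_inv_mat M ** grade_inv_mat N"
  for M N :: "('p::finite, 'q::finite, 'g::{finite,linorder}) supermatrix"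
  by (simp add: vec_eq_iff matrix_matrix_mult_def grade_inv_sum grade_inv_mult)

lemma grade_inv_mat_minus: "grade_inv_mat (- M) = - grade_inv_mat M"
  by (simp add: vec_eq_iff)

lemma grade_inv_mat_E: "grade_inv_mat E = E"
  by (simp add: vec_eq_iff E_def)

lemma grade_inv_mat_one: "grade_inv_mat (mat 1) = mat 1"
  by (simp add: vec_eq_iff mat_def)

text \<open>Conjugation by \<open>E\<close> changes the sign of exactly the off-diagonal blocks.
  Parity thereby becomes an equation that products and inverses can be substituted into.\<close>

lemma bosonic_mat_iff: "bosonic_mat M \<longleftrightarrow> grade_inv_mat M = E ** M ** E"
proof -
  have "(grade_inv_mat M = E ** M ** E) \<longleftrightarrow>
      (\<forall>i j. grade_inv (M $ i $ j) = (if isl i = isl j then M $ i $ j else - M $ i $ j))"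
    unfolding vec_eq_iff mult_E_nth E_mult_nth grade_inv_mat_nth
    by (intro all_cong1) auto
  then show ?thesis
    unfolding bosonic_mat_def bosonic_iff_grade_inv fermionic_iff_grade_inv by (simp cong: if_cong)
qed

lemma bosonic_mat_mult:
  assumes "bosonic_mat M" "bosonic_mat N"
  shows "bosonic_mat (M ** N)"
  using assms by (simp add: bosonic_mat_iff grade_inv_mat_mult E_E_mult flip: matrix_mul_assoc)

lemma bosonic_mat_E: "bosonic_mat E"
  by (simp add: bosonic_mat_iff grade_inv_mat_E E_E)

lemma bosonic_mat_minus: "bosonic_mat M \<Longrightarrow> bosonic_mat (- M)"
  for M :: "('p::finite, 'q::finite, 'g::{finite,linorder}) supermatrix"
  by (simp add: bosonic_mat_iff grade_inv_mat_minus matrix_mult_minus_left matrix_mult_minus_right)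

text \<open>Both \<open>grade_inv_mat N\<close> and \<open>E ** N ** E\<close> invert
  \<open>E ** M ** E\<close>, so they agree by uniqueness of inverses.\<close>

lemma bosonic_mat_inverse:
  assumes M: "bosonic_mat M" and MN: "M ** N = mat 1" "N ** M = mat 1"
  shows "bosonic_mat N"
proof -
  have "grade_inv_mat N ** (E ** M ** E) = mat 1"
    using M MN(2) grade_inv_mat_mult[of N M] by (simp add: bosonic_mat_iff grade_inv_mat_one)
  then have "grade_inv_mat N ** (E ** M ** E) ** (E ** N ** E) = E ** N ** E"
    by simp
  moreover have "(E ** M ** E) ** (E ** N ** E) = mat 1"
  proof -
    have "(E ** M ** E) ** (E ** N ** E) = E ** ((M ** N) ** E)"
      by (simp add: E_E_mult flip: matrix_mul_assoc)
    then show ?thesis by (simp add: MN E_E)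
  qed
  ultimately show ?thesis
    by (simp add: bosonic_mat_iff flip: matrix_mul_assoc[of "grade_inv_mat N"])
qed

section \<open>Covariant derivatives of matrix fields\<close>

definition differentiable_mat :: "('p::finite, 'q::finite, 'g) matrix_field \<Rightarrow> real^2 \<Rightarrow> bool" where
  "differentiable_mat M x \<longleftrightarrow> (\<forall>i j. differentiable_field (\<lambda>y. M y $ i $ j) x)"

lemma smooth_differentiable_mat:
  "open \<Omega> \<Longrightarrow> smooth_mat \<Omega> M \<Longrightarrow> x \<in> \<Omega> \<Longrightarrow> differentiable_mat M x"
  unfolding differentiable_mat_def smooth_mat_def using smooth_differentiable_field by blast

text \<open>The derivative acts entrywise without block signs, so the twist is the entrywise
  involution, which for even M turns into conjugation by \<open>E\<close>.\<close>

lemma cov_mat_mult: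
  assumes "differentiable_mat M x" "differentiable_mat N x"
  shows "cov_mat j (\<lambda>y. M y ** N y) x = cov_mat j M x ** N x + grade_inv_mat (M x) ** cov_mat j N x"
proof -
  have "cov j (\<lambda>y. \<Sum>k\<in>UNIV. M y $ a $ k * N y $ k $ b) x =
      (\<Sum>k\<in>UNIV. cov j (\<lambda>y. M y $ a $ k) x * N x $ k $ b +
        grade_inv (M x $ a $ k) * cov j (\<lambda>y. N y $ k $ b) x)" for a b
    using assms unfolding differentiable_mat_def
    by (subst cov_sum) (auto simp: cov_times differentiable_field_times)
  then show ?thesis
    by (simp add: vec_eq_iff cov_mat_def matrix_matrix_mult_def sum.distrib)
qed

lemma cov_mat_cong:
  assumes "open \<Omega>" "x \<in> \<Omega>" "\<And>y. y \<in> \<Omega> \<Longrightarrow> M y = N y"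
  shows "cov_mat j M x = cov_mat j N x"
proof -
  have "cov j (\<lambda>y. M y $ a $ b) x = cov j (\<lambda>y. N y $ a $ b) x" for a b
    by (rule cov_cong[OF assms(1,2)]) (simp add: assms(3))
  then show ?thesis by (simp add: cov_mat_def)
qed

lemma cov_mat_add:
  assumes "differentiable_mat M x" "differentiable_mat N x"
  shows "cov_mat j (\<lambda>y. M y + N y) x = cov_mat j M x + cov_mat j N x"
  using assms
  by (auto simp: vec_eq_iff grassmann_eq_iff cov_mat_def coeff_cov partial_add differentiable_mat_def
      differentiable_field_def algebra_simps)

lemma cov_mat_minus:
  assumes "differentiable_mat M x"
  shows "cov_mat j (\<lambda>y. - M y) x = - cov_mat j M x"
proof -
  have "partial j (\<lambda>y. - coeff (M y $ a $ b) S) x = - partial j (\<lambda>y. coeff (M y $ a $ b) S) x" for a b S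
    using assms partial_cmult[of "\<lambda>y. coeff (M y $ a $ b) S" x j "-1"]
    by (simp add: differentiable_mat_def differentiable_field_def)
  then show ?thesis
    by (simp add: vec_eq_iff grassmann_eq_iff cov_mat_def coeff_cov)
qed

lemma cov_mat_E: "cov_mat j (\<lambda>y. E) x = 0"
  by (simp add: vec_eq_iff cov_mat_def cov_const E_def dgen_one dgen_minus)

lemma cov_mat_mat: "dgen (Theta j) c = 0 \<Longrightarrow> cov_mat j (\<lambda>y. mat c) x = 0"
  by (simp add: vec_eq_iff cov_mat_def cov_const mat_def)

lemma differentiable_mat_const: "differentiable_mat (\<lambda>y. M) x"
  by (simp add: differentiable_mat_def differentiable_field_def)

lemma differentiable_mat_mult:
  assumes "differentiable_mat M x" "differentiable_mat N x"
  shows "differentiable_mat (\<lambda>y. M y ** N y) x"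
  using assms unfolding differentiable_mat_def matrix_matrix_mult_def differentiable_field_def
  by (auto simp: coeff_sum coeff_times intro!: differentiable_sum differentiable_mult)

lemma differentiable_mat_add:
  assumes "differentiable_mat M x" "differentiable_mat N x"
  shows "differentiable_mat (\<lambda>y. M y + N y) x"
  using assms unfolding differentiable_mat_def differentiable_field_def by auto

lemma smooth_mat_const: "smooth_mat \<Omega> (\<lambda>y. M)"
  by (simp add: smooth_mat_def smooth_const)

lemma smooth_mat_mult:
  assumes "open \<Omega>" "smooth_mat \<Omega> M" "smooth_mat \<Omega> N"
  shows "smooth_mat \<Omega> (\<lambda>y. M y ** N y)"
  using assms unfolding smooth_mat_def matrix_matrix_mult_def
  by (auto intro!: smooth_sum smooth_times)

lemma smooth_mat_minus:
  assumes "open \<Omega>" "smooth_mat \<Omega> M"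
  shows "smooth_mat \<Omega> (\<lambda>y. - M y)"
  using assms smooth_fun_mult[OF assms(1) smooth_fun_const[of \<Omega> "-1"]]
  by (simp add: smooth_mat_def smooth_iff)

text \<open>
  Left multiplication by \<open>M\<close> as a complex matrix: Cramer's rule then expresses the coefficients
  of the inverse of \<open>M\<close> as quotients of determinants, which are smooth.
\<close>

definition regular_rep ::
    "'g::{finite,linorder} grassmann^'n^'n \<Rightarrow> complex^('n \<times> 'g set)^('n \<times> 'g set)" where
  "regular_rep M = (\<chi> r c. if snd c \<subseteq> snd r
     then koszul (snd r - snd c) (snd c) * coeff (M $ fst r $ fst c) (snd r - snd c) else 0)"

text \<open>A complex vector indexed by pairs (k, T) codes a column of Grassmann elements; in this
  coding the complex matrix acts as M does.\<close>

lemma regular_rep_mult: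
  fixes M :: "'g::{finite,linorder} grassmann^'n::finite^'n"
  shows "(regular_rep M *v v) $ (i, S) = coeff (\<Sum>k\<in>UNIV. M $ i $ k * Grassmann (\<lambda>T. v $ (k, T))) S"
proof -
  have "(regular_rep M *v v) $ (i, S) = (\<Sum>k\<in>UNIV. \<Sum>T\<in>UNIV. (if T \<subseteq> S
      then koszul (S - T) T * coeff (M $ i $ k) (S - T) else 0) * v $ (k, T))"
    by (simp add: matrix_vector_mult_def regular_rep_def sum.cartesian_product case_prod_unfold
        flip: UNIV_Times_UNIV cong: if_cong)
  also have "\<dots> = (\<Sum>k\<in>UNIV. \<Sum>T\<in>Pow S. koszul (S - T) T * coeff (M $ i $ k) (S - T) * v $ (k, T))"
    by (intro sum.cong sum.mono_neutral_cong_right) auto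
  also have "\<dots> = (\<Sum>k\<in>UNIV. \<Sum>T\<in>Pow S. koszul T (S - T) * coeff (M $ i $ k) T * v $ (k, S - T))"
    by (intro sum.cong[OF refl] sum.reindex_bij_witness[of _ "\<lambda>T. S - T" "\<lambda>T. S - T"])
      (auto simp: double_diff)
  finally show ?thesis by (simp add: coeff_sum coeff_times)
qed

text \<open>A kernel vector decodes to a Grassmann column annihilated by M, and multiplying by N
  shows that this column is zero. Injectivity suffices because the complex matrix is square.\<close>

lemma det_regular_rep:
  fixes M N :: "'g::{finite,linorder} grassmann^'n::finite^'n"
  assumes "N ** M = mat 1"
  shows "det (regular_rep M) \<noteq> 0"
proof -
  have "v = 0" if v: "regular_rep M *v v = 0" for v
  proof -
    define w where "w = (\<chi> k. Grassmann (\<lambda>T. v $ (k, T)))"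
    have "coeff ((M *v w) $ i) S = 0" for i S
    proof -
      have "coeff ((M *v w) $ i) S = (regular_rep M *v v) $ (i, S)"
        unfolding regular_rep_mult by (simp add: matrix_vector_mult_def w_def)
      then show ?thesis by (simp add: v)
    qed
    then have "M *v w = 0"
      by (simp add: vec_eq_iff grassmann_eq_iff)
    then have "(N ** M) *v w = 0"
      by (metis matrix_vector_mul_assoc matrix_vector_mult_0_right)
    then have "w = 0" by (simp add: assms)
    then have "coeff (w $ k) T = 0" for k T by simp
    then show ?thesis by (simp add: w_def vec_eq_iff)
  qed
  then show ?thesis
    by (metis invertible_det_nz invertible_left_inverse matrix_left_invertible_ker)
qed

lemma smooth_mat_inverse:
  fixes M N :: "('p::finite, 'q::finite, 'g::{finite,linorder}) matrix_field"
  assumes \<Omega>: "open \<Omega>" and M: "smooth_mat \<Omega> M"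
    and MN: "\<And>x. x \<in> \<Omega> \<Longrightarrow> M x ** N x = mat 1" "\<And>x. x \<in> \<Omega> \<Longrightarrow> N x ** M x = mat 1"
  shows "smooth_mat \<Omega> N"
  unfolding smooth_mat_def smooth_iff
proof (intro allI)
  fix a b S
  \<comment> \<open>Column b of N solves the system with matrix M and right-hand side column b of
    the identity. Coded over the complex numbers, this right-hand side is e, the matrix is K, and L
    is K with column (a, S) replaced by e, as in the numerator of Cramer's rule.\<close>
  define e :: "complex^(('p + 'q) \<times> 'g generator set)" where
    "e = (\<chi> r. coeff ((mat 1 :: ('p, 'q, 'g) supermatrix) $ fst r $ b) (snd r))"
  define K where "K x = regular_rep (M x)" for x
  define L where "L x = (\<chi> i j. if j = (a, S) then e $ i else K x $ i $ j)" for x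
  have smoothK: "smooth_fun \<Omega> (\<lambda>x. K x $ r $ c)" for r c
  proof (cases "snd c \<subseteq> snd r")
    case True
    then have "(\<lambda>x. K x $ r $ c) =
        (\<lambda>x. koszul (snd r - snd c) (snd c) * coeff (M x $ fst r $ fst c) (snd r - snd c))"
      by (simp add: K_def regular_rep_def)
    then show ?thesis
      using M by (simp add: smooth_fun_mult[OF \<Omega> smooth_fun_const] smooth_mat_def smooth_iff)
  next
    case False
    then show ?thesis by (simp add: K_def regular_rep_def smooth_fun_const)
  qed
  have smoothL: "smooth_fun \<Omega> (\<lambda>x. L x $ r $ c)" for r c
    using smoothK by (cases "c = (a, S)") (simp_all add: L_def smooth_fun_const)
  have detK: "det (K x) \<noteq> 0" if "x \<in> \<Omega>" for x
    unfolding K_def using MN(2)[OF that] by (rule det_regular_rep)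
  have "coeff (N x $ a $ b) S = det (L x) / det (K x)" if x: "x \<in> \<Omega>" for x
  proof -
    define v where "v = (\<chi> r. coeff (N x $ fst r $ b) (snd r))"
    have v: "Grassmann (\<lambda>T. v $ (k, T)) = N x $ k $ b" for k
      by (simp add: v_def grassmann_eq_iff)
    have "(K x *v v) $ r = e $ r" for r
    proof -
      have "(K x *v v) $ (fst r, snd r) = coeff ((M x ** N x) $ fst r $ b) (snd r)"
        unfolding K_def regular_rep_mult v by (simp add: matrix_matrix_mult_def)
      then show ?thesis by (simp add: MN(1)[OF x] e_def)
    qed
    then have "K x *v v = e" by (simp add: vec_eq_iff)
    then have v_eq: "v = (\<chi> k. det (\<chi> i j. if j = k then e $ i else K x $ i $ j) / det (K x))"
      by (rule cramer[OF detK[OF x], THEN iffD1])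
    have "v $ (a, S) = det (L x) / det (K x)"
      unfolding v_eq L_def by (rule vec_lambda_beta)
    then show ?thesis by (simp add: v_def)
  qed
  moreover have "smooth_fun \<Omega> (\<lambda>x. det (L x) / det (K x))"
    by (intro smooth_fun_divide smooth_fun_det \<Omega> smoothK smoothL detK)
  ultimately show "smooth_fun \<Omega> (\<lambda>x. coeff (N x $ a $ b) S)"
    using smooth_fun_cong[OF \<Omega>, of "\<lambda>x. coeff (N x $ a $ b) S" "\<lambda>x. det (L x) / det (K x)"] by blast
qed

section \<open>Existence of the immersion\<close>

text \<open>With odd scalars written as scalar matrices, all later computations are associative
  matrix algebra.\<close>

lemma scale_mat_eq_mult: "scale_mat c M = mat c ** M"
  by (simp add: vec_eq_iff scale_mat_def mat_mult_nth)

lemma grade_inv_mat_mat: "grade_inv_mat (mat c) = mat (grade_inv c)"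
  by (simp add: vec_eq_iff mat_def)

lemma mult_mat_fermionic:
  assumes "fermionic c"
  shows "M ** mat c = mat c ** grade_inv_mat M"
  using fermionic_times[OF assms, of "grade_inv a" for a]
  by (simp add: vec_eq_iff mat_mult_nth mult_mat_nth)

lemma cov_mat_E_mult:
  assumes "differentiable_mat M x"
  shows "cov_mat j (\<lambda>y. E ** M y) x = E ** cov_mat j M x"
  by (simp add: cov_mat_mult[OF differentiable_mat_const assms] cov_mat_E grade_inv_mat_E)

lemma GL_field_inverse:
  assumes \<Omega>: "open \<Omega>" and \<Psi>: "GL_field \<Omega> \<Psi>"
  shows "\<And>x. x \<in> \<Omega> \<Longrightarrow> \<Psi> x ** matrix_inv (\<Psi> x) = mat 1"
    and "\<And>x. x \<in> \<Omega> \<Longrightarrow> matrix_inv (\<Psi> x) ** \<Psi> x = mat 1"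
    and "bosonic_field \<Omega> (\<lambda>x. matrix_inv (\<Psi> x))"
proof -
  show 1: "\<Psi> x ** matrix_inv (\<Psi> x) = mat 1" "matrix_inv (\<Psi> x) ** \<Psi> x = mat 1" if "x \<in> \<Omega>" for x
    using \<Psi> that by (auto simp: GL_field_def GL_def matrix_inv_mult)
  show "bosonic_field \<Omega> (\<lambda>x. matrix_inv (\<Psi> x))"
    unfolding bosonic_field_def
  proof
    show "smooth_mat \<Omega> (\<lambda>x. matrix_inv (\<Psi> x))"
      using \<Psi> by (intro smooth_mat_inverse[OF \<Omega> _ 1]) (auto simp: GL_field_def)
    show "\<forall>x\<in>\<Omega>. bosonic_mat (matrix_inv (\<Psi> x))"
      using \<Psi> bosonic_mat_inverse[OF _ 1] by (auto simp: GL_field_def GL_def)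
  qed
qed

lemma LSP_D: "LSP \<Omega> U \<Psi> \<Longrightarrow> x \<in> \<Omega> \<Longrightarrow> cov_mat j \<Psi> x = U j x ** \<Psi> x"
  by (simp add: LSP_def)

text \<open>The formula results from differentiating
  \<open>\<Psi> x ** matrix_inv (\<Psi> x) = mat 1\<close> and solving for the second factor; both
  \<open>E\<close> come from the twist on the even \<open>\<Psi>\<close>.\<close>

lemma cov_mat_inverse:
  fixes \<Psi> :: "('p::finite, 'q::finite, 'g::{finite,linorder}) matrix_field"
  assumes \<Omega>: "open \<Omega>" and \<Psi>: "GL_field \<Omega> \<Psi>" and LSP: "LSP \<Omega> U \<Psi>" and x: "x \<in> \<Omega>"
  shows "cov_mat j (\<lambda>y. matrix_inv (\<Psi> y)) x = - (E ** (matrix_inv (\<Psi> x) ** (E ** U j x)))"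
proof -
  let ?\<Phi> = "\<lambda>y. matrix_inv (\<Psi> y)"
  note inv = GL_field_inverse[OF \<Omega> \<Psi>]
  have d\<Psi>: "differentiable_mat \<Psi> x"
    using smooth_differentiable_mat[OF \<Omega> _ x] \<Psi> by (auto simp: GL_field_def)
  have d\<Phi>: "differentiable_mat ?\<Phi> x"
    using smooth_differentiable_mat[OF \<Omega> _ x] inv(3) by (auto simp: bosonic_field_def)
  have \<tau>: "grade_inv_mat (\<Psi> x) = E ** \<Psi> x ** E"
    using \<Psi> x by (auto simp: GL_field_def GL_def bosonic_mat_iff)
  have "0 = cov_mat j (\<lambda>y. mat 1 :: ('p, 'q, 'g) supermatrix) x"
    by (simp add: cov_mat_mat dgen_one)
  also have "\<dots> = cov_mat j (\<lambda>y. \<Psi> y ** ?\<Phi> y) x"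
    by (rule cov_mat_cong[OF \<Omega> x]) (simp add: inv(1))
  also have "\<dots> = U j x ** (\<Psi> x ** ?\<Phi> x) + E ** (\<Psi> x ** (E ** cov_mat j ?\<Phi> x))"
    by (simp add: cov_mat_mult[OF d\<Psi> d\<Phi>] LSP_D[OF LSP x] \<tau> flip: matrix_mul_assoc)
  finally have "E ** (\<Psi> x ** (E ** cov_mat j ?\<Phi> x)) = - U j x"
    by (simp add: inv(1)[OF x] eq_neg_iff_add_eq_0 add.commute)
  then have "E ** (?\<Phi> x ** (E ** (E ** (\<Psi> x ** (E ** cov_mat j ?\<Phi> x))))) = E ** (?\<Phi> x ** (E ** - U j x))"
    by simp
  moreover have "?\<Phi> x ** (\<Psi> x ** M) = M" for M :: "('p, 'q, 'g) supermatrix"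
    by (simp add: matrix_mul_assoc inv(2)[OF x])
  ultimately show ?thesis
    by (simp add: E_E_mult matrix_mult_minus_right)
qed

text \<open>Up to sign and conjugation by \<open>\<Psi>\<close>, D_i B_j is D_i A_j +
  [E A_j, E U_i]. Summing over (i, j) = (1, 2) and (2, 1) gives exactly the expression in the
  deformed ZCC.\<close>

lemma tangent_compatibility:
  assumes \<Omega>: "open \<Omega>" and \<Psi>: "GL_field \<Omega> \<Psi>" and LSP: "LSP \<Omega> U \<Psi>"
    and A: "\<And>j. bosonic_field \<Omega> (A j)"
    and ZCC: "deformed_ZCC \<Omega> U A" and x: "x \<in> \<Omega>"
  defines "B \<equiv> \<lambda>j y. - (E ** (matrix_inv (\<Psi> y) ** (E ** (A j y ** \<Psi> y))))"
  shows "cov_mat 1 (B 2) x + cov_mat 2 (B 1) x = 0"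
proof -
  define \<Phi> where "\<Phi> = (\<lambda>y. matrix_inv (\<Psi> y))"
  note inv = GL_field_inverse[OF \<Omega> \<Psi>]
  have d\<Psi>: "differentiable_mat \<Psi> x"
    using smooth_differentiable_mat[OF \<Omega> _ x] \<Psi> by (auto simp: GL_field_def)
  have d\<Phi>: "differentiable_mat \<Phi> x"
    using smooth_differentiable_mat[OF \<Omega> _ x] inv(3) by (auto simp: bosonic_field_def \<Phi>_def)
  have dA: "differentiable_mat (A j) x" for j
    using smooth_differentiable_mat[OF \<Omega> _ x] A by (auto simp: bosonic_field_def)
  have \<tau>\<Phi>: "grade_inv_mat (\<Phi> x) = E ** \<Phi> x ** E"
    using inv(3) x by (auto simp: bosonic_field_def bosonic_mat_iff \<Phi>_def)
  have \<tau>A: "grade_inv_mat (A j x) = E ** A j x ** E" for j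
    using A x by (auto simp: bosonic_field_def bosonic_mat_iff)
  have d\<Phi>_eq: "cov_mat i \<Phi> x = - (E ** (\<Phi> x ** (E ** U i x)))" for i
    unfolding \<Phi>_def by (rule cov_mat_inverse[OF \<Omega> \<Psi> LSP x])
  note d = differentiable_mat_mult differentiable_mat_const d\<Psi> d\<Phi> dA
  \<comment> \<open>The term with \<open>E ** A j x\<close> in front comes from differentiating
    \<open>\<Psi>\<close>, the one with \<open>E ** U i x\<close> in front from differentiating its
    inverse; the twists make their signs opposite.\<close>
  have cov_B: "cov_mat i (B j) x =
      - (\<Phi> x ** ((cov_mat i (A j) x + (E ** A j x) ** (E ** U i x) - (E ** U i x) ** (E ** A j x)) ** \<Psi> x))"
    for i j
  proof -
    have "cov_mat i (B j) x = - (E ** cov_mat i (\<lambda>y. \<Phi> y ** (E ** (A j y ** \<Psi> y))) x)"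
      unfolding B_def \<Phi>_def[symmetric] fun_cong[OF \<Phi>_def, symmetric]
      by (subst cov_mat_minus cov_mat_E_mult, (intro d)[1])+ simp
    also have "cov_mat i (\<lambda>y. \<Phi> y ** (E ** (A j y ** \<Psi> y))) x =
        cov_mat i \<Phi> x ** (E ** (A j x ** \<Psi> x)) +
        E ** \<Phi> x ** E ** (E ** (cov_mat i (A j) x ** \<Psi> x + E ** A j x ** E ** (U i x ** \<Psi> x)))"
      by (simp add: cov_mat_mult cov_mat_E_mult d \<tau>\<Phi> \<tau>A LSP_D[OF LSP x] cov_mat_E grade_inv_mat_E)
    finally show ?thesis
      by (simp add: d\<Phi>_eq matrix_ring_simps E_E_mult flip: matrix_mul_assoc)
  qed
  have "cov_mat 1 (B 2) x + cov_mat 2 (B 1) x = - (\<Phi> x ** ((cov_mat 1 (A 2) x + cov_mat 2 (A 1) x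
     + comm_mat (E ** A 1 x) (E ** U 2 x) + comm_mat (E ** A 2 x) (E ** U 1 x)) ** \<Psi> x))"
    unfolding cov_B comm_mat_def by (simp add: matrix_ring_simps)
  also have "\<dots> = 0"
    using ZCC x by (simp add: deformed_ZCC_def matrix_matrix_mult_def vec_eq_iff)
  finally show ?thesis .
qed

lemma cov_mat_potential:
  fixes B :: "2 \<Rightarrow> ('p::finite, 'q::finite, 'g::{finite,linorder}) matrix_field"
  assumes \<Omega>: "open \<Omega>" "simply_connected \<Omega>"
    and B: "\<And>j. bosonic_field \<Omega> (B j)"
    and compat: "\<And>x. x \<in> \<Omega> \<Longrightarrow> cov_mat 1 (B 2) x + cov_mat 2 (B 1) x = 0"
  obtains F where "fermionic_field \<Omega> F" "\<And>j x. x \<in> \<Omega> \<Longrightarrow> cov_mat j F x = B j x"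
proof -
  let ?P = "\<lambda>a b f. smooth \<Omega> f \<and> (\<forall>j. \<forall>x\<in>\<Omega>. cov j f x = B j x $ a $ b) \<and>
    (\<forall>x\<in>\<Omega>. if isl a = isl b then fermionic (f x) else bosonic (f x))"
  have "\<exists>f. ?P a b f" for a b
  proof -
    have "smooth \<Omega> (\<lambda>x. B j x $ a $ b)" for j
      using B by (simp add: bosonic_field_def smooth_mat_def)
    moreover have "cov 1 (\<lambda>x. B 2 x $ a $ b) x + cov 2 (\<lambda>x. B 1 x $ a $ b) x = 0" if "x \<in> \<Omega>" for x
      using compat[OF that] by (simp add: vec_eq_iff cov_mat_def)
    \<comment> \<open>In a diagonal block the entries of B are even and F must be odd; off the
      diagonal it is the reverse. Hence the parity flag is
      \<open>isl a \<noteq> isl b\<close>.\<close>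
    moreover have "coeff (B j x $ a $ b) S = 0" if "x \<in> \<Omega>" "even (card S) = (isl a \<noteq> isl b)" for j x S
      using B that unfolding bosonic_field_def bosonic_mat_def bosonic_def fermionic_def by metis
    ultimately obtain f where "smooth \<Omega> f" "\<And>j x. x \<in> \<Omega> \<Longrightarrow> cov j f x = B j x $ a $ b"
      "\<And>x S. x \<in> \<Omega> \<Longrightarrow> even (card S) \<noteq> (isl a \<noteq> isl b) \<Longrightarrow> coeff (f x) S = 0"
      by (rule cov_potential[OF \<Omega>, where B = "\<lambda>j x. B j x $ a $ b"]) blast+
    then show ?thesis by (intro exI[of _ f]) (auto simp: fermionic_def bosonic_def)
  qed
  then have P: "?P a b (SOME f. ?P a b f)" for a b
    by (rule someI_ex)
  define F :: "('p, 'q, 'g) matrix_field" where "F x = (\<chi> a b. (SOME f. ?P a b f) x)" for x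
  show ?thesis
  proof
    show "fermionic_field \<Omega> F"
      using P unfolding fermionic_field_def fermionic_mat_def smooth_mat_def F_def vec_lambda_beta
      by blast
    show "cov_mat j F x = B j x" if "x \<in> \<Omega>" for j x
      using P that unfolding vec_eq_iff cov_mat_def F_def vec_lambda_beta by blast
  qed
qed

lemma immersion_exists:
  assumes \<Omega>: "open \<Omega>" "simply_connected \<Omega>"
    and \<Psi>: "GL_field \<Omega> \<Psi>" and LSP: "LSP \<Omega> U \<Psi>"
    and A: "\<And>j. bosonic_field \<Omega> (A j)" and ZCC: "deformed_ZCC \<Omega> U A"
  obtains F where "fermionic_field \<Omega> F"
    "\<And>j x. x \<in> \<Omega> \<Longrightarrow> tangent_vector F j x = - (matrix_inv (\<Psi> x) ** E ** A j x ** \<Psi> x)"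
proof -
  \<comment> \<open>Multiplying the tangent vector equation by \<open>E\<close> isolates D_j F on
    the left.\<close>
  define B where "B j y = - (E ** (matrix_inv (\<Psi> y) ** (E ** (A j y ** \<Psi> y))))" for j y
  note inv = GL_field_inverse(3)[OF \<Omega>(1) \<Psi>]
  have "bosonic_field \<Omega> (B j)" for j
    using inv A \<Psi> unfolding bosonic_field_def GL_field_def GL_def B_def
    by (auto intro!: smooth_mat_minus smooth_mat_mult smooth_mat_const \<Omega>(1)
        bosonic_mat_minus bosonic_mat_mult bosonic_mat_E)
  moreover have "cov_mat 1 (B 2) x + cov_mat 2 (B 1) x = 0" if "x \<in> \<Omega>" for x
    unfolding B_def by (rule tangent_compatibility[OF \<Omega>(1) \<Psi> LSP A ZCC that])
  ultimately obtain F where F: "fermionic_field \<Omega> F" "\<And>j x. x \<in> \<Omega> \<Longrightarrow> cov_mat j F x = B j x"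
    using cov_mat_potential[OF \<Omega>] by metis
  show ?thesis
  proof
    show "tangent_vector F j x = - (matrix_inv (\<Psi> x) ** E ** A j x ** \<Psi> x)" if "x \<in> \<Omega>" for j x
      unfolding tangent_vector_def F(2)[OF that] B_def
      by (simp add: matrix_mult_minus_right E_E_mult flip: matrix_mul_assoc)
  qed (rule F(1))
qed

lemma deformed_LSP:
  fixes \<Psi> :: "('p::finite, 'q::finite, 'g::{finite,linorder}) matrix_field"
  assumes \<Omega>: "open \<Omega>" and \<Psi>: "GL_field \<Omega> \<Psi>" and LSP: "LSP \<Omega> U \<Psi>"
    and \<epsilon>: "fermionic_parameter \<epsilon>" and F: "fermionic_field \<Omega> F"
    and tangent: "\<And>j x. x \<in> \<Omega> \<Longrightarrow> tangent_vector F j x = - (matrix_inv (\<Psi> x) ** E ** A j x ** \<Psi> x)"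
  shows "LSP \<Omega> (\<lambda>j. deformed_U \<epsilon> (U j) (A j)) (deformed_\<Psi> \<epsilon> \<Psi> F)"
  unfolding LSP_def
proof (intro allI ballI)
  fix j x assume x: "x \<in> \<Omega>"
  have \<epsilon>_odd: "fermionic \<epsilon>" and d\<epsilon>: "dgen (Theta i) \<epsilon> = 0" for i
    using \<epsilon> by (auto simp: fermionic_parameter_def)
  have d\<Psi>: "differentiable_mat \<Psi> x"
    using smooth_differentiable_mat[OF \<Omega> _ x] \<Psi> by (auto simp: GL_field_def)
  have dF: "differentiable_mat F x"
    using smooth_differentiable_mat[OF \<Omega> _ x] F by (auto simp: fermionic_field_def)
  have \<tau>\<Psi>: "grade_inv_mat (\<Psi> x) = E ** \<Psi> x ** E"
    using \<Psi> x by (auto simp: GL_field_def GL_def bosonic_mat_iff)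
  have \<tau>\<epsilon>: "grade_inv_mat (mat \<epsilon>) = - mat \<epsilon>"
    using \<epsilon>_odd by (simp add: grade_inv_mat_mat fermionic_iff_grade_inv vec_eq_iff mat_def)
  \<comment> \<open>The two factors \<open>\<epsilon>\<close> are separated by M; moving the second
    one to the left twists M and brings them together.\<close>
  have \<epsilon>\<epsilon>: "mat \<epsilon> ** (M ** (mat \<epsilon> ** N)) = 0" for M N :: "('p, 'q, 'g) supermatrix"
  proof -
    have "mat \<epsilon> ** (M ** (mat \<epsilon> ** N)) = (mat \<epsilon> ** mat \<epsilon>) ** (grade_inv_mat M ** N)"
      by (metis matrix_mul_assoc mult_mat_fermionic[OF \<epsilon>_odd])
    also have "mat \<epsilon> ** mat \<epsilon> = 0"
      by (simp add: vec_eq_iff mat_mult_nth) (simp add: mat_def fermionic_square[OF \<epsilon>_odd])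
    finally show ?thesis by (simp add: matrix_matrix_mult_def vec_eq_iff)
  qed
  note d = differentiable_mat_mult differentiable_mat_add differentiable_mat_const d\<Psi> dF
  have ET: "E ** cov_mat j F x = - (matrix_inv (\<Psi> x) ** (E ** (A j x ** \<Psi> x)))"
    using tangent[OF x, of j] by (simp add: tangent_vector_def flip: matrix_mul_assoc)
  \<comment> \<open>The minus sign, from passing the odd \<open>\<epsilon>\<close>, later cancels
    the one in the tangent vector equation.\<close>
  have "cov_mat j (\<lambda>y. mat 1 + mat \<epsilon> ** (E ** F y)) x = - (mat \<epsilon> ** (E ** cov_mat j F x))"
    by (simp add: cov_mat_add cov_mat_mult d cov_mat_mat dgen_one d\<epsilon> \<tau>\<epsilon> cov_mat_E grade_inv_mat_E
        matrix_mult_minus_left)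
  then have "cov_mat j (deformed_\<Psi> \<epsilon> \<Psi> F) x =
      U j x ** \<Psi> x ** (mat 1 + mat \<epsilon> ** (E ** F x)) +
      grade_inv_mat (\<Psi> x) ** (mat \<epsilon> ** (matrix_inv (\<Psi> x) ** (E ** (A j x ** \<Psi> x))))"
    unfolding deformed_\<Psi>_def scale_mat_eq_mult
    by (simp add: cov_mat_mult d LSP_D[OF LSP x] ET matrix_mult_minus_right)
  also have "grade_inv_mat (\<Psi> x) ** (mat \<epsilon> ** (matrix_inv (\<Psi> x) ** (E ** (A j x ** \<Psi> x)))) =
      mat \<epsilon> ** (\<Psi> x ** (matrix_inv (\<Psi> x) ** (E ** (A j x ** \<Psi> x))))"
  proof -
    \<comment> \<open>Moving \<open>\<epsilon>\<close> to the left applies the involution a second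
      time and undoes the twist, leaving \<open>\<Psi> x\<close> itself next to its inverse.\<close>
    have "grade_inv_mat (\<Psi> x) ** mat \<epsilon> = mat \<epsilon> ** \<Psi> x"
      by (simp add: mult_mat_fermionic[OF \<epsilon>_odd] vec_eq_iff mat_mult_nth)
    then show ?thesis by (simp only: matrix_mul_assoc)
  qed
  also have "\<Psi> x ** (matrix_inv (\<Psi> x) ** (E ** (A j x ** \<Psi> x))) = E ** (A j x ** \<Psi> x)"
    by (simp add: matrix_mul_assoc GL_field_inverse(1)[OF \<Omega> \<Psi> x])
  also have "U j x ** \<Psi> x ** (mat 1 + mat \<epsilon> ** (E ** F x)) + mat \<epsilon> ** (E ** (A j x ** \<Psi> x)) =
      deformed_U \<epsilon> (U j) (A j) x ** deformed_\<Psi> \<epsilon> \<Psi> F x"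
  proof -
    have "mat \<epsilon> ** (E ** (A j x ** (\<Psi> x ** (mat \<epsilon> ** (E ** F x))))) = 0"
      using \<epsilon>\<epsilon>[of "E ** (A j x ** \<Psi> x)" "E ** F x"] by (simp flip: matrix_mul_assoc)
    then show ?thesis
      unfolding deformed_U_def deformed_\<Psi>_def scale_mat_eq_mult
      by (simp add: matrix_ring_simps flip: matrix_mul_assoc)
  qed
  finally show "cov_mat j (deformed_\<Psi> \<epsilon> \<Psi> F) x - deformed_U \<epsilon> (U j) (A j) x ** deformed_\<Psi> \<epsilon> \<Psi> F x = 0"
    by simp
qed

theorem proposition2:
  fixes \<Omega> :: "(real^2) set"
    and \<Lambda> :: "complex set"
    and odd_field :: "'k \<Rightarrow> bool"
    and \<Delta> :: "'l \<Rightarrow> ('k, 'g::{finite,linorder}) jet \<Rightarrow> 'g generator grassmann"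
    and U :: "2 \<Rightarrow> complex \<Rightarrow> ('k, 'g) jet \<Rightarrow> ('p::finite, 'q::finite, 'g) supermatrix"
    and \<Psi> :: "complex \<Rightarrow> ('k \<Rightarrow> 'g superfield) \<Rightarrow> ('p, 'q, 'g) matrix_field"
    and A :: "2 \<Rightarrow> complex \<Rightarrow> ('k, 'g) jet \<Rightarrow> ('p, 'q, 'g) supermatrix"
    and \<epsilon> :: "'g generator grassmann"
  assumes "open \<Omega>" and "simply_connected \<Omega>"
    and U_fermionic: "\<And>j lam u. lam \<in> \<Lambda> \<Longrightarrow> u \<in> field_configs \<Omega> odd_field \<Longrightarrow>
      fermionic_field \<Omega> (\<lambda>x. U j lam (jet u x))"
    and \<Psi>_GL: "\<And>lam u. lam \<in> \<Lambda> \<Longrightarrow> u \<in> solutions \<Omega> odd_field \<Delta> \<Longrightarrow> GL_field \<Omega> (\<Psi> lam u)"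
    and LSP: "\<And>lam u. lam \<in> \<Lambda> \<Longrightarrow> u \<in> solutions \<Omega> odd_field \<Delta> \<Longrightarrow>
      LSP \<Omega> (\<lambda>j x. U j lam (jet u x)) (\<Psi> lam u)"
    and ZCC_iff: "\<And>lam u. lam \<in> \<Lambda> \<Longrightarrow> u \<in> field_configs \<Omega> odd_field \<Longrightarrow>
      ZCC \<Omega> (\<lambda>j x. U j lam (jet u x)) \<longleftrightarrow> u \<in> solutions \<Omega> odd_field \<Delta>"
    and \<epsilon>: "fermionic_parameter \<epsilon>"
    and A_bosonic: "\<And>j lam u. lam \<in> \<Lambda> \<Longrightarrow> u \<in> solutions \<Omega> odd_field \<Delta> \<Longrightarrow>
      bosonic_field \<Omega> (\<lambda>x. A j lam (jet u x))"
    and deformed_ZCC: "\<And>lam u. lam \<in> \<Lambda> \<Longrightarrow> u \<in> solutions \<Omega> odd_field \<Delta> \<Longrightarrow>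
      deformed_ZCC \<Omega> (\<lambda>j x. U j lam (jet u x)) (\<lambda>j x. A j lam (jet u x))"
  shows "\<exists>F :: complex \<Rightarrow> ('k \<Rightarrow> 'g superfield) \<Rightarrow> ('p, 'q, 'g) matrix_field.
    \<forall>lam\<in>\<Lambda>. \<forall>u\<in>solutions \<Omega> odd_field \<Delta>.
      fermionic_field \<Omega> (F lam u) \<and>
      LSP \<Omega> (\<lambda>j. deformed_U \<epsilon> (\<lambda>x. U j lam (jet u x)) (\<lambda>x. A j lam (jet u x)))
        (deformed_\<Psi> \<epsilon> (\<Psi> lam u) (F lam u)) \<and>
      (\<forall>j. \<forall>x\<in>\<Omega>. tangent_vector (F lam u) j x =
        - (matrix_inv (\<Psi> lam u x) ** E ** A j lam (jet u x) ** \<Psi> lam u x)) \<and>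
      ((\<forall>x\<in>\<Omega>. lin_independent
          (\<lambda>j. - (matrix_inv (\<Psi> lam u x) ** E ** A j lam (jet u x) ** \<Psi> lam u x))) \<longrightarrow>
        immersed_surface \<Omega> (F lam u))"
proof -
  let ?P = "\<lambda>lam u F. fermionic_field \<Omega> F \<and>
      LSP \<Omega> (\<lambda>j. deformed_U \<epsilon> (\<lambda>x. U j lam (jet u x)) (\<lambda>x. A j lam (jet u x)))
        (deformed_\<Psi> \<epsilon> (\<Psi> lam u) F) \<and>
      (\<forall>j. \<forall>x\<in>\<Omega>. tangent_vector F j x =
        - (matrix_inv (\<Psi> lam u x) ** E ** A j lam (jet u x) ** \<Psi> lam u x))"
  have "\<exists>F. ?P lam u F" if lu: "lam \<in> \<Lambda>" "u \<in> solutions \<Omega> odd_field \<Delta>" for lam u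
  proof -
    obtain F where F: "fermionic_field \<Omega> F" "\<And>j x. x \<in> \<Omega> \<Longrightarrow> tangent_vector F j x =
        - (matrix_inv (\<Psi> lam u x) ** E ** A j lam (jet u x) ** \<Psi> lam u x)"
      by (rule immersion_exists[OF assms(1,2) \<Psi>_GL[OF lu] LSP[OF lu] A_bosonic[OF lu]
            deformed_ZCC[OF lu]]) blast
    then show ?thesis
      using deformed_LSP[OF assms(1) \<Psi>_GL[OF lu] LSP[OF lu] \<epsilon> F] by blast
  qed
  then have P: "?P lam u (SOME F. ?P lam u F)"
    if "lam \<in> \<Lambda>" "u \<in> solutions \<Omega> odd_field \<Delta>" for lam u
    using someI_ex[of "?P lam u"] that by blast
  \<comment> \<open>By the tangent equations, independence of the prescribed vectors is independence
    of the actual tangent vectors of the chosen F.\<close>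
  show ?thesis
    by (rule exI[of _ "\<lambda>lam u. SOME F. ?P lam u F"], intro ballI)
      (use P in \<open>simp add: immersed_surface_def\<close>)
qed

end
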